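(* Let $I$ be an open subset of $\mathbb{R}$. Assume that $\{f_\alpha:\mathbb{D}\to\mathbb{C}\}_{\alpha\in I}$ is an $\mathbb{R}$-analytic family of holomorphic maps which fix $0$ with multiplier $e^{2\pi i\alpha}$. The following are equivalent: \begin{enumerate} \item the family $\{f_\alpha\}_{\alpha\in I}$ is degenerate; \item there exist a non-empty open interval $J\subset I$, a real $\delta>0$ and an analytic map $\phi:J\times B(0,\delta)\to\mathbb{C}$ such that, writing $\phi_\alpha=\phi(\alpha,\cdot)$, for all $\alpha\in J$ one has $\phi_\alpha(z)=z+\mathcal{O}(z^2)$ at $0$, and $f_\alpha=\phi_\alpha\circ R_\alpha\circ\phi_\alpha^{-1}$ in the sense that $\phi_\alpha(B(0,\delta))\subset\mathbb{D}$ and $\phi_\alpha(R_\alpha(z))=f_\alpha(\phi_\alpha(z))$ for all $z\in B(0,\delta)$. \end{enumerate}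
   Context: $\mathbb{D}$ is the open unit disk, $B(0,\delta)$ the open disk of radius $\delta$ in $\mathbb{C}$, and $R_\alpha(z)=e^{2\pi i\alpha}z$. The family being $\mathbb{R}$-analytic means that $(\alpha,z)\mapsto f_\alpha(z)$ is analytic (real-analytic in $\alpha\in I$, holomorphic in $z$); likewise, $\phi$ analytic means real-analytic in $\alpha$ and holomorphic in $z$, jointly. The map $f_\alpha$ is linearizable if it is conjugate near $0$ to $R_\alpha$ by a holomorphic local diffeomorphism fixing $0$. The family is degenerate if the set $\{\alpha\in I: f_\alpha\text{ is not linearizable}\}$ is not dense in $I$. *)

theory Defs
  imports "HOL-Complex_Analysis.Complex_Analysis" "HOL-Library.Landau_Symbols"
begin

text \<open>
  Joint analyticity in a real and a complex variable: real-analytic in the first, holomorphic in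
  the second. Around every point the function is the sum of a convergent double power series (with
  complex coefficients). It is meant for open sets only: then the radius can always be taken so
  small that no value of the function outside the set matters.
\<close>

definition real_complex_analytic_on ::
    "(real \<Rightarrow> complex \<Rightarrow> complex) \<Rightarrow> (real \<times> complex) set \<Rightarrow> bool" where
  "real_complex_analytic_on F S \<longleftrightarrow>
     (\<forall>(a, w) \<in> S. \<exists>(c :: nat \<Rightarrow> nat \<Rightarrow> complex) r. r > 0 \<and>
        (\<forall>x \<in> ball a r. \<forall>z \<in> ball w r.
           ((\<lambda>(j, k). c j k * of_real (x - a) ^ j * (z - w) ^ k) has_sum F x z) UNIV))"

definition rot :: "real \<Rightarrow> complex \<Rightarrow> complex" where
  "rot \<alpha> z = exp (2 * of_real pi * \<i> * of_real \<alpha>) * z"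

text \<open>
  Here \<open>h\<close> is a biholomorphism, with inverse \<open>k\<close>, between two open neighbourhoods of \<open>0\<close>.
  The conjugacy is an identity of germs, so only the values of \<open>g\<close> near \<open>0\<close> matter.
\<close>

definition linearizable :: "(complex \<Rightarrow> complex) \<Rightarrow> real \<Rightarrow> bool" where
  "linearizable g \<alpha> \<longleftrightarrow>
     (\<exists>h k U V. open U \<and> open V \<and> 0 \<in> U \<and> 0 \<in> V \<and>
        h holomorphic_on U \<and> k holomorphic_on V \<and> homeomorphism U V h k \<and> h 0 = 0 \<and>
        (\<forall>\<^sub>F z in nhds 0. h (rot \<alpha> z) = g (h z)))"

definition degenerate :: "(real \<Rightarrow> complex \<Rightarrow> complex) \<Rightarrow> real set \<Rightarrow> bool" where
  "degenerate f I \<longleftrightarrow> \<not> I \<subseteq> closure {\<alpha> \<in> I. \<not> linearizable (f \<alpha>) \<alpha>}"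

end

theory Submission imports Defs begin

unbundle no vec_syntax

text \<open>
  The coefficients \<open>b\<^sub>n(\<alpha>)\<close> of the normalized formal linearization satisfy
  \<open>b\<^sub>n (\<mu>\<^sup>n - \<mu>) = Q\<^sub>n\<close> with \<open>\<mu> = exp (2 \<pi> \<i> \<alpha>)\<close> and \<open>Q\<^sub>n\<close> depending on the earlier ones. Let
  \<open>\<alpha>\<close> become complex. The small divisors vanish only at rational \<open>\<alpha>\<close>, to first order, and there
  linearizability forces \<open>Q\<^sub>n = 0\<close>. Hence every \<open>b\<^sub>n\<close> is holomorphic on one fixed disk around a point of
  the real axis. Off the axis the multiplier is not unimodular, and Koenigs' majorant gives
  \<open>\<bar>b\<^sub>n\<bar> \<le> (C / \<bar>Im \<alpha>\<bar>)\<^bsup>n-1\<^esup>\<close>. The maximum principle removes this singularity along the real axis,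
  at the price of a smaller disk, so \<open>\<Sum> b\<^sub>n(\<alpha>) z\<^sup>n\<close> is jointly analytic.
\<close>

section \<open>Formal linearization\<close>

text \<open>Linearizability at each single real \<alpha> gives no radius that is uniform in
  \<alpha>, and on the real axis the small divisors have no uniform lower bound. So the hypothesis
  is used only qualitatively: it enters as an identity of formal series, and only at resonances,
  where it makes the homological equation solvable. All estimates come from non-real \<alpha>. At a
  resonance the equation leaves the coefficient free; holomorphy in \<alpha> selects a value, which
  need not be that of the given linearization. The blow-up exponent grows only linearly with the
  degree, so removing it costs one constant factor per degree and geometric growth survives. Once
  the series converges, the identity theorem turns the formal conjugacy into a true one. In the
  converse direction \<open>\<phi> \<alpha>\<close> is itself a linearization.\<close>

text \<open>In \<open>A ^ i - B ^ i = (A - B) * S\<close> the cofactor \<open>S\<close> has zero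
  constant term because \<open>i\<close> is at least 2, so a difference starting in degree
  \<open>n\<close> only shows up from degree \<open>n + 1\<close> on. This is what makes the
  homological equations recursive.\<close>

lemma fps_power_nth_cong:
  fixes A B :: "'a::idom fps"
  assumes "A $ 0 = 0" "B $ 0 = 0" "\<And>m. m < n \<Longrightarrow> A $ m = B $ m" "2 \<le> i"
  shows "(A ^ i) $ n = (B ^ i) $ n"
proof -
  define S where "S = (\<Sum>j<i. A ^ j * B ^ (i - Suc j))"
  have S0: "S $ 0 = 0"
    unfolding S_def fps_sum_nth
  proof (rule sum.neutral, safe)
    fix j assume "j < i"
    then have "j \<noteq> 0 \<or> i - Suc j \<noteq> 0" using assms(4) by linarith
    then show "(A ^ j * B ^ (i - Suc j)) $ 0 = 0"
      using assms(1,2) by (auto simp: power_0_left)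
  qed
  have "A ^ i - B ^ i = (A - B) * S"
    unfolding S_def by (simp add: power_diff_sumr2 mult.commute)
  then have "(A ^ i - B ^ i) $ n = (\<Sum>k=0..n. (A - B) $ k * S $ (n - k))"
    by (simp add: fps_mult_nth)
  also have "\<dots> = 0"
  proof (rule sum.neutral, safe)
    fix k assume "k \<in> {0..n}"
    then show "(A - B) $ k * S $ (n - k) = 0"
      using assms(3)[of k] S0 by (cases "k = n") auto
  qed
  finally show ?thesis by simp
qed

text \<open>Isolates the linear term: when \<open>A $ 0 = 0\<close>, the previous lemma shows that
  the remaining sum involves only coefficients of \<open>A\<close> below degree
  \<open>n\<close>.\<close>

lemma fps_compose_nth_split:
  fixes F A :: "'a::idom fps"
  assumes "n \<ge> 1"
  shows "(F oo A) $ n = F $ 1 * A $ n + (\<Sum>i=2..n. F $ i * (A ^ i) $ n)"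
proof -
  have "{0..n} = insert 0 (insert 1 {2..n})" using assms by auto
  then show ?thesis using assms by (simp add: fps_compose_nth)
qed

lemma fps_power_nth_cong_le:
  fixes A B :: "'a::comm_ring_1 fps"
  assumes "\<And>k. k \<le> m \<Longrightarrow> A $ k = B $ k"
  shows "(A ^ i) $ m = (B ^ i) $ m"
  using assms
proof (induction i arbitrary: m)
  case (Suc i)
  then show ?case by (auto simp: fps_mult_nth intro!: sum.cong)
qed simp

lemma fps_compose_nth_cong:
  fixes A B :: "'a::comm_ring_1 fps"
  assumes "\<And>k. k \<le> m \<Longrightarrow> A $ k = B $ k"
  shows "(F oo A) $ m = (F oo B) $ m"
  unfolding fps_compose_nth using fps_power_nth_cong_le[OF assms] by (intro sum.cong) auto

text \<open>The linearization equation is nonlinear in \<open>H\<close>, but linear in its inverse.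
  In the latter form it can be composed on the right with an arbitrary series.\<close>

lemma fps_compose_conjugate:
  fixes F H :: "'a::field fps"
  assumes "H $ 0 = 0" "H $ 1 \<noteq> 0" "F $ 0 = 0"
    and "F oo H = H oo (fps_const \<mu> * fps_X)"
  shows "fps_inv H oo F = fps_const \<mu> * fps_inv H"
proof -
  let ?K = "fps_inv H"
  have K0: "?K $ 0 = 0" by (simp add: fps_inv_def)
  have L0: "(fps_const \<mu> * fps_X) $ 0 = 0" by simp
  have "?K oo F = ?K oo F oo (H oo ?K)"
    using fps_inv_right[OF assms(1,2)] by simp
  also have "\<dots> = ?K oo (F oo H) oo ?K"
    using assms(1,3) K0 by (simp add: fps_compose_assoc)
  also have "\<dots> = (?K oo H) oo (fps_const \<mu> * fps_X) oo ?K"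
    using assms(1,4) by (simp add: fps_compose_assoc)
  also have "\<dots> = fps_const \<mu> * ?K"
    using fps_inv[OF assms(1,2)] K0 by (simp add: fps_compose_mult_distrib)
  finally show ?thesis .
qed

text \<open>At a resonance \<open>\<mu> ^ n = \<mu>\<close> the solvability obstruction of the \<open>n\<close>-th homological
  equation vanishes for every truncated solution, not only for the truncations of \<open>H\<close>.\<close>

lemma fps_resonance:
  fixes F H \<psi> :: "'a::field fps"
  assumes H: "H $ 0 = 0" "H $ 1 \<noteq> 0" and F: "F $ 0 = 0" "F $ 1 = \<mu>"
    and lin: "F oo H = H oo (fps_const \<mu> * fps_X)"
    and n: "2 \<le> n" "\<mu> ^ n = \<mu>"
    and \<psi>: "\<psi> $ 0 = 0" "\<And>m. m < n \<Longrightarrow> (F oo \<psi>) $ m = \<mu> ^ m * \<psi> $ m"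
  shows "(\<Sum>i=2..n. F $ i * (\<psi> ^ i) $ n) = 0"
proof -
  define K where "K = fps_inv H"
  have K0: "K $ 0 = 0" and K1: "K $ 1 \<noteq> 0"
    using H by (auto simp: K_def fps_inv_def)
  have KF: "K oo F = fps_const \<mu> * K"
    unfolding K_def by (rule fps_compose_conjugate) (use assms in auto)
  \<comment> \<open>\<open>A\<close> and \<open>B\<close> are the two sides of the linearization
    equation for \<open>\<psi>\<close>, equal below degree \<open>n\<close>. After applying
    \<open>K\<close>, their \<open>n\<close>-th coefficients are \<open>\<mu>\<close> and
    \<open>\<mu> ^ n\<close> times that of \<open>K oo \<psi>\<close>, hence equal at a resonance.
    Cancelling what depends on lower degrees only leaves \<open>A $ n = B $ n\<close>.\<close>
  define A where "A = F oo \<psi>"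
  define B where "B = \<psi> oo (fps_const \<mu> * fps_X)"
  have B: "B $ m = \<mu> ^ m * \<psi> $ m" for m
    by (simp add: B_def fps_compose_linear)
  have A0: "A $ 0 = 0" "B $ 0 = 0" using F \<psi> by (auto simp: A_def B)
  have AB: "A $ m = B $ m" if "m < n" for m using \<psi>(2)[OF that] B by (simp add: A_def)
  have "K oo A = fps_const \<mu> * (K oo \<psi>)"
    unfolding A_def using F \<psi> KF by (simp add: fps_compose_assoc fps_compose_mult_distrib)
  then have 1: "(K oo A) $ n = \<mu> * (K oo \<psi>) $ n" by simp
  have "K oo B = (K oo \<psi>) oo (fps_const \<mu> * fps_X)"
    unfolding B_def using \<psi> by (simp add: fps_compose_assoc)
  then have "(K oo B) $ n = \<mu> ^ n * (K oo \<psi>) $ n" by (simp add: fps_compose_linear)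
  then have "(K oo A) $ n = (K oo B) $ n" using 1 n by simp
  moreover have "(\<Sum>i=2..n. K $ i * (A ^ i) $ n) = (\<Sum>i=2..n. K $ i * (B ^ i) $ n)"
    using fps_power_nth_cong[OF A0 AB] by (intro sum.cong) auto
  ultimately have "K $ 1 * A $ n = K $ 1 * B $ n"
    using n by (simp add: fps_compose_nth_split)
  then have "A $ n = B $ n" using K1 by simp
  then show ?thesis using n F by (simp add: A_def B fps_compose_nth_split)
qed

section \<open>Koenigs' majorant for the formal linearization\<close>

text \<open>The weighted sum of absolute values up to degree \<open>N\<close> is submultiplicative:
  the products involved range over a triangle of index pairs, which is enlarged to the
  square.\<close>

lemma fps_power_majorant:
  fixes A :: "complex fps"
  assumes "t \<ge> 0"
  shows "(\<Sum>n\<le>N. norm ((A ^ i) $ n) * t ^ n) \<le> (\<Sum>n\<le>N. norm (A $ n) * t ^ n) ^ i"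
proof (induction i)
  case 0
  have "(\<Sum>n\<le>N. norm ((1 :: complex fps) $ n) * t ^ n) = (\<Sum>n\<le>N. if n = 0 then 1 else 0)"
    by (intro sum.cong) auto
  then show ?case by simp
next
  case (Suc i)
  define a where "a n = norm (A $ n) * t ^ n" for n
  define b where "b n = norm ((A ^ i) $ n) * t ^ n" for n
  have nn: "a n \<ge> 0" "b n \<ge> 0" for n using assms by (auto simp: a_def b_def)
  have "(\<Sum>n\<le>N. norm ((A ^ Suc i) $ n) * t ^ n) \<le> (\<Sum>n\<le>N. \<Sum>k\<le>n. a k * b (n - k))"
  proof (rule sum_mono)
    fix n
    have "norm ((A ^ Suc i) $ n) \<le> (\<Sum>k=0..n. norm (A $ k) * norm ((A ^ i) $ (n - k)))"
      unfolding power_Suc fps_mult_nth by (rule sum_norm_le) (simp add: norm_mult)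
    then have "norm ((A ^ Suc i) $ n) * t ^ n
        \<le> (\<Sum>k=0..n. norm (A $ k) * norm ((A ^ i) $ (n - k))) * t ^ n"
      using assms by (intro mult_right_mono) auto
    also have "\<dots> = (\<Sum>k\<le>n. a k * b (n - k))"
      unfolding a_def b_def sum_distrib_right atMost_atLeast0
      by (intro sum.cong refl) (auto simp: power_add[symmetric])
    finally show "norm ((A ^ Suc i) $ n) * t ^ n \<le> (\<Sum>k\<le>n. a k * b (n - k))" .
  qed
  also have "\<dots> = (\<Sum>(k, l)\<in>{(k, l). k + l \<le> N}. a k * b l)"
    by (rule sum.triangle_reindex_eq[symmetric])
  also have "\<dots> \<le> (\<Sum>(k, l)\<in>{..N} \<times> {..N}. a k * b l)"
    by (rule sum_mono2) (auto simp: nn)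
  also have "\<dots> = (\<Sum>n\<le>N. a n) * (\<Sum>n\<le>N. b n)"
    by (simp add: sum_product sum.cartesian_product)
  also have "\<dots> \<le> (\<Sum>n\<le>N. a n) * (\<Sum>n\<le>N. a n) ^ i"
    using Suc.IH by (intro mult_left_mono) (auto simp: a_def b_def sum_nonneg assms)
  finally show ?case by (simp add: a_def)
qed

text \<open>Induction on the partial sums: the linear term contributes \<open>t\<close>, and the
  rest must contribute at most \<open>t\<close>. The condition \<open>4 * s * t \<le> 1\<close>
  makes the geometric ratio \<open>s * T\<close> at most 1/2, so that its series is at most 2; the
  rest, times \<open>\<epsilon>\<close>, is then at most \<open>2 * M * (2 * s * t)\<^sup>2\<close>,
  and the second condition bounds this by \<open>\<epsilon> * t\<close>.\<close>

lemma linearization_majorant: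
  fixes F \<phi> :: "complex fps"
  assumes \<phi>: "\<phi> $ 0 = 0" "\<phi> $ 1 = 1" "\<And>n. (F oo \<phi>) $ n = \<mu> ^ n * \<phi> $ n"
    and F: "F $ 1 = \<mu>" "\<And>k. 2 \<le> k \<Longrightarrow> norm (F $ k) \<le> M * s ^ k"
    and pos: "s \<ge> 0" "M \<ge> 0" "t \<ge> 0" "\<epsilon> > 0"
    and \<epsilon>: "\<And>n. 2 \<le> n \<Longrightarrow> \<epsilon> \<le> norm (\<mu> ^ n - \<mu>)"
    and t: "4 * s * t \<le> 1" "8 * M * s\<^sup>2 * t \<le> \<epsilon>"
  shows "norm (\<phi> $ n) * t ^ n \<le> 2 * t"
proof -
  have S: "(\<Sum>n\<le>N. norm (\<phi> $ n) * t ^ n) \<le> 2 * t" for N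
  proof (induction N)
    case 0
    then show ?case using \<phi> pos by simp
  next
    case (Suc N)
    show ?case
    proof (cases "N = 0")
      case True
      then show ?thesis using \<phi> pos by simp
    next
      case False
      \<comment> \<open>Truncation at degree \<open>N\<close> suffices: for \<open>i\<close> at
        least 2, the coefficients of \<open>\<phi> ^ i\<close> up to degree \<open>Suc N\<close>
        involve \<open>\<phi>\<close> only up to degree \<open>N\<close>, where the induction
        hypothesis applies.\<close>
      define A where "A = Abs_fps (\<lambda>n. if n \<le> N then \<phi> $ n else 0)"
      define T where "T = (\<Sum>n\<le>N. norm (\<phi> $ n) * t ^ n)"
      have T: "0 \<le> T" "T \<le> 2 * t"
        using Suc.IH pos by (auto simp: T_def sum_nonneg)
      have TA: "(\<Sum>n\<le>Suc N. norm (A $ n) * t ^ n) = T"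
        unfolding T_def A_def by simp
      have st: "s * T \<le> 1 / 2"
        using mult_left_mono[OF T(2) pos(1)] t by simp
      have sT0: "0 \<le> s * T" using pos T by simp
      have pt: "norm (\<phi> $ n) * t ^ n * \<epsilon> \<le> (\<Sum>i=2..Suc N. M * s ^ i * (norm ((A ^ i) $ n) * t ^ n))"
        if n: "n \<in> {2..Suc N}" for n
      proof -
        have "\<phi> $ n * (\<mu> ^ n - \<mu>) = (\<Sum>i=2..n. F $ i * (\<phi> ^ i) $ n)"
          using \<phi>(3)[of n] F n by (simp add: fps_compose_nth_split algebra_simps)
        also have "\<dots> = (\<Sum>i=2..n. F $ i * (A ^ i) $ n)"
          using n \<phi> by (intro sum.cong refl arg_cong2[where f="(*)"] fps_power_nth_cong)
            (auto simp: A_def)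
        finally have e: "\<phi> $ n * (\<mu> ^ n - \<mu>) = (\<Sum>i=2..n. F $ i * (A ^ i) $ n)" .
        have "norm (\<phi> $ n) * \<epsilon> \<le> norm (\<phi> $ n * (\<mu> ^ n - \<mu>))"
          using \<epsilon>[of n] n by (simp add: norm_mult mult_left_mono)
        also have "\<dots> \<le> (\<Sum>i=2..n. M * s ^ i * norm ((A ^ i) $ n))"
          unfolding e using F by (intro sum_norm_le) (auto simp: norm_mult intro!: mult_right_mono)
        also have "\<dots> \<le> (\<Sum>i=2..Suc N. M * s ^ i * norm ((A ^ i) $ n))"
          using n pos by (intro sum_mono2) auto
        finally have "norm (\<phi> $ n) * \<epsilon> * t ^ n \<le> (\<Sum>i=2..Suc N. M * s ^ i * norm ((A ^ i) $ n)) * t ^ n"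
          using pos by (intro mult_right_mono) auto
        then show ?thesis
          unfolding sum_distrib_right by (simp add: mult_ac del: sum.cl_ivl_Suc power_Suc)
      qed
      have "(\<Sum>n=2..Suc N. norm (\<phi> $ n) * t ^ n) * \<epsilon>
          \<le> (\<Sum>n=2..Suc N. \<Sum>i=2..Suc N. M * s ^ i * (norm ((A ^ i) $ n) * t ^ n))"
        unfolding sum_distrib_right by (intro sum_mono pt)
      also have "\<dots> = (\<Sum>i=2..Suc N. M * s ^ i * (\<Sum>n=2..Suc N. norm ((A ^ i) $ n) * t ^ n))"
        unfolding sum_distrib_left by (rule sum.swap)
      also have "\<dots> \<le> (\<Sum>i=2..Suc N. M * (s * T) ^ i)"
      proof (rule sum_mono)
        fix i
        have "(\<Sum>n=2..Suc N. norm ((A ^ i) $ n) * t ^ n) \<le> (\<Sum>n\<le>Suc N. norm ((A ^ i) $ n) * t ^ n)"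
          using pos by (intro sum_mono2) auto
        also have "\<dots> \<le> T ^ i"
          using fps_power_majorant[OF pos(3), of A i "Suc N"] TA by simp
        finally show "M * s ^ i * (\<Sum>n=2..Suc N. norm ((A ^ i) $ n) * t ^ n) \<le> M * (s * T) ^ i"
          using pos by (simp add: mult_left_mono power_mult_distrib mult.assoc)
      qed
      also have "\<dots> = M * (s * T)\<^sup>2 * (\<Sum>i<N. (s * T) ^ i)"
      proof -
        have "(\<Sum>i=2..Suc N. M * (s * T) ^ i) = (\<Sum>i=0+2..<N+2. M * (s * T) ^ i)"
          by (intro sum.cong) auto
        also have "\<dots> = (\<Sum>i<N. M * (s * T) ^ (i + 2))"
          unfolding sum.shift_bounds_nat_ivl by (simp add: atLeast0LessThan)
        also have "\<dots> = M * (s * T)\<^sup>2 * (\<Sum>i<N. (s * T) ^ i)"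
          unfolding power_add sum_distrib_left by (simp add: mult_ac)
        finally show ?thesis .
      qed
      also have "\<dots> \<le> M * (s * T)\<^sup>2 * 2"
      proof (rule mult_left_mono)
        have "(\<Sum>i<N. (s * T) ^ i) = (1 - (s * T) ^ N) / (1 - s * T)"
          using st by (simp add: sum_gp_strict)
        also have "\<dots> \<le> 1 / (1 / 2)"
          using st sT0 by (intro frac_le) auto
        finally show "(\<Sum>i<N. (s * T) ^ i) \<le> 2" by simp
      qed (use pos in auto)
      also have "\<dots> \<le> M * (s * (2 * t))\<^sup>2 * 2"
        using T pos by (intro mult_right_mono mult_left_mono power_mono) auto
      also have "\<dots> = (8 * M * s\<^sup>2 * t) * t" by (simp add: power2_eq_square)
      also have "\<dots> \<le> \<epsilon> * t" using t pos by (intro mult_right_mono) auto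
      finally have "(\<Sum>n=2..Suc N. norm (\<phi> $ n) * t ^ n) \<le> t"
        using pos by (simp add: mult.commute)
      moreover have "{..Suc N} = insert 0 (insert 1 {2..Suc N})" by auto
      ultimately show ?thesis using \<phi> by simp
    qed
  qed
  have "norm (\<phi> $ n) * t ^ n \<le> (\<Sum>n\<le>n. norm (\<phi> $ n) * t ^ n)"
    using pos by (intro member_le_sum) auto
  then show ?thesis using S[of n] by linarith
qed

section \<open>Holomorphic dependence on a complex rotation number\<close>

text \<open>Only the moduli are compared, which makes the bound independent of \<open>n\<close>. For
  \<open>y \<ge> 0\<close> the gap is at least
  \<open>m - m\<^sup>2 = m\<^sup>2 * (exp (2 * pi * y) - 1)\<close>, and
  \<open>exp (- 4 * pi)\<close> is the least value of \<open>m\<^sup>2\<close> for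
  \<open>y \<le> 1\<close>. For \<open>y < 0\<close> the modulus exceeds 1 and \<open>m - 1\<close>
  already suffices.\<close>

lemma multiplier_gap:
  fixes \<xi> :: complex
  assumes "\<bar>Im \<xi>\<bar> \<le> 1" "2 \<le> n"
  shows "exp (- 4 * pi) * \<bar>Im \<xi>\<bar>
    \<le> norm (exp (2 * of_real pi * \<i> * \<xi>) ^ n - exp (2 * of_real pi * \<i> * \<xi>))"
proof -
  define \<mu> where "\<mu> = exp (2 * of_real pi * \<i> * \<xi>)"
  define y where "y = Im \<xi>"
  define m where "m = exp (- 2 * pi * y)"
  have m: "norm \<mu> = m" by (simp add: \<mu>_def m_def y_def norm_exp_eq_Re)
  have pi: "u \<le> 2 * pi * u" if "u \<ge> 0" for u :: real
    using mult_right_mono[OF _ that, of 1 "2 * pi"] pi_gt3 by simp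
  have "exp (- 4 * pi) * \<bar>y\<bar> \<le> \<bar>m ^ n - m\<bar>"
  proof (cases "y \<ge> 0")
    case True
    have m1: "m \<le> 1" "m > 0" using True by (auto simp: m_def)
    have "exp (- 4 * pi) \<le> m * m"
      using assms True unfolding m_def by (simp add: y_def flip: exp_add)
    then have "exp (- 4 * pi) * y \<le> (m * m) * (2 * pi * y)"
      using True pi by (intro mult_mono) auto
    also have "\<dots> \<le> (m * m) * (exp (2 * pi * y) - 1)"
    proof (rule mult_left_mono)
      show "2 * pi * y \<le> exp (2 * pi * y) - 1"
        using exp_ge_add_one_self[of "2 * pi * y"] by linarith
    qed simp
    also have "\<dots> = m - m ^ 2"
      by (simp add: m_def algebra_simps power2_eq_square flip: exp_add)
    also have "\<dots> \<le> m - m ^ n"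
      using m1 assms by (simp add: power_decreasing)
    finally show ?thesis using True by linarith
  next
    case False
    have m1: "m \<ge> 1" using False by (simp add: m_def mult_nonneg_nonpos)
    have "exp (- 4 * pi) * \<bar>y\<bar> \<le> 1 * \<bar>y\<bar>" by (intro mult_right_mono) auto
    also have "\<dots> \<le> - 2 * pi * y" using False pi[of "- y"] by simp
    also have "\<dots> \<le> m - 1" using exp_ge_add_one_self[of "- 2 * pi * y"] by (simp add: m_def)
    also have "\<dots> \<le> m * (m - 1)" using m1 by (simp add: mult_le_cancel_right1)
    also have "\<dots> = m ^ 2 - m" by (simp add: algebra_simps power2_eq_square)
    also have "\<dots> \<le> m ^ n - m" using m1 assms by (simp add: power_increasing)
    finally show ?thesis by linarith
  qed
  also have "\<dots> = \<bar>norm (\<mu> ^ n) - norm \<mu>\<bar>" by (simp add: m norm_power)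
  also have "\<dots> \<le> norm (\<mu> ^ n - \<mu>)" by (rule norm_triangle_ineq3)
  finally show ?thesis by (simp add: \<mu>_def y_def)
qed

text \<open>
  On the circle of radius \<open>\<rho>\<close> about the real point \<open>a\<close> one has
  \<open>\<bar>(\<xi> - a)\<^sup>2 - \<rho>\<^sup>2\<bar> = 2 \<rho> \<bar>Im \<xi>\<bar>\<close>, so the \<open>m\<close>-th power of this quadratic polynomial absorbs
  the blow-up at the real axis.
\<close>

lemma holomorphic_bound_across_real_axis:
  fixes g :: "complex \<Rightarrow> complex"
  assumes g: "g holomorphic_on ball (of_real a) R" and \<rho>: "0 < \<rho>" "\<rho> < R"
    and B: "\<And>\<xi>. \<xi> \<in> sphere (of_real a) \<rho> \<Longrightarrow> norm (g \<xi>) * \<bar>Im \<xi>\<bar> ^ m \<le> B"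
    and \<xi>: "\<xi> \<in> cball (of_real a) (\<rho> / 2)"
  shows "norm (g \<xi>) \<le> B * (8 / (3 * \<rho>)) ^ m"
proof -
  define G where "G = (\<lambda>\<xi>. g \<xi> * ((\<xi> - of_real a)\<^sup>2 - of_real (\<rho>\<^sup>2)) ^ m)"
  have sub: "cball (of_real a) \<rho> \<subseteq> ball (of_real a :: complex) R" using \<rho> by auto
  have hG: "G holomorphic_on ball (of_real a) R"
    unfolding G_def by (intro holomorphic_intros g)
  have "norm (G \<xi>) \<le> B * (2 * \<rho>) ^ m"
  proof (rule maximum_modulus_frontier[of G "cball (of_real a) \<rho>"])
    show "G holomorphic_on interior (cball (of_real a) \<rho>)"
      using hG sub by (meson holomorphic_on_subset interior_subset order_trans)
    show "continuous_on (closure (cball (of_real a) \<rho>)) G"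
      using hG sub by (auto intro: holomorphic_on_imp_continuous_on holomorphic_on_subset)
    show "\<xi> \<in> cball (of_real a) \<rho>" using \<xi> \<rho> by auto
    fix z :: complex assume "z \<in> frontier (cball (of_real a) \<rho>)"
    then have z: "norm (z - of_real a) = \<rho>"
      using \<rho> by (simp add: frontier_cball dist_norm norm_minus_commute)
    define w where "w = z - of_real a"
    have "of_real (\<rho>\<^sup>2) = w * cnj w"
      using z by (metis complex_norm_square w_def)
    then have "w\<^sup>2 - of_real (\<rho>\<^sup>2) = w * (w - cnj w)"
      by (simp add: power2_eq_square algebra_simps)
    also have "w - cnj w = of_real (2 * Im z) * \<i>"
      by (simp add: complex_eq_iff w_def)
    finally have "norm (w\<^sup>2 - of_real (\<rho>\<^sup>2)) = 2 * \<rho> * \<bar>Im z\<bar>"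
      using z by (simp add: w_def norm_mult)
    then have "norm (G z) = (norm (g z) * \<bar>Im z\<bar> ^ m) * (2 * \<rho>) ^ m"
      by (simp add: G_def w_def[symmetric] norm_mult norm_power power_mult_distrib)
    also have "\<dots> \<le> B * (2 * \<rho>) ^ m"
      using B[of z] z \<rho> by (intro mult_right_mono) (auto simp: dist_norm norm_minus_commute)
    finally show "norm (G z) \<le> B * (2 * \<rho>) ^ m" .
  qed auto
  \<comment> \<open>On the half-size disk the quadratic factor is at least
    \<open>\<rho>\<^sup>2 - \<rho>\<^sup>2 / 4\<close>. Dividing \<open>2 * \<rho>\<close> by this
    gives the constant \<open>8 / (3 * \<rho>)\<close>.\<close>
  moreover have "norm (g \<xi>) * (3 * \<rho>\<^sup>2 / 4) ^ m \<le> norm (G \<xi>)"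
  proof -
    have "norm ((\<xi> - of_real a)\<^sup>2) \<le> (\<rho> / 2)\<^sup>2"
      unfolding norm_power using \<xi> by (intro power_mono) (auto simp: dist_norm norm_minus_commute)
    moreover have "norm (of_real (\<rho>\<^sup>2) :: complex) = \<rho>\<^sup>2"
      by (simp add: norm_power)
    ultimately have "3 * \<rho>\<^sup>2 / 4 \<le> norm ((\<xi> - of_real a)\<^sup>2 - of_real (\<rho>\<^sup>2))"
      using norm_triangle_ineq3[of "(\<xi> - of_real a)\<^sup>2" "of_real (\<rho>\<^sup>2)"]
      by (simp add: power_divide)
    then show ?thesis
      unfolding G_def norm_mult norm_power using \<rho> by (intro mult_left_mono power_mono) auto
  qed
  ultimately have "norm (g \<xi>) * (3 * \<rho>\<^sup>2 / 4) ^ m \<le> B * (2 * \<rho>) ^ m" by linarith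
  then have "norm (g \<xi>) \<le> B * (2 * \<rho>) ^ m / (3 * \<rho>\<^sup>2 / 4) ^ m"
    using \<rho> by (simp add: pos_le_divide_eq)
  also have "\<dots> = B * (2 * \<rho> / (3 * \<rho>\<^sup>2 / 4)) ^ m" by (simp only: power_divide times_divide_eq_right)
  also have "2 * \<rho> / (3 * \<rho>\<^sup>2 / 4) = 8 / (3 * \<rho>)"
    using \<rho> by (simp add: field_simps power2_eq_square)
  finally show ?thesis .
qed

text \<open>At a simple zero of \<open>D\<close> that is also a zero of \<open>Q\<close>, the
  quotient tends to the quotient of the derivatives, so the singularity is removable. The conclusion
  is stated as a product so that it covers these zeros too, where both sides vanish.\<close>

lemma holomorphic_quotient_simple_zeros:
  fixes Q D :: "complex \<Rightarrow> complex"
  assumes W: "open W" and hol: "Q holomorphic_on W" "D holomorphic_on W"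
    and zeros: "\<And>\<xi>. \<xi> \<in> W \<Longrightarrow> D \<xi> = 0 \<Longrightarrow> deriv D \<xi> \<noteq> 0 \<and> Q \<xi> = 0"
  obtains b where "b holomorphic_on W" "\<And>\<xi>. \<xi> \<in> W \<Longrightarrow> b \<xi> * D \<xi> = Q \<xi>"
proof
  define b where "b = remove_sings (\<lambda>\<xi>. Q \<xi> / D \<xi>)"
  have an: "Q analytic_on {\<xi>}" "D analytic_on {\<xi>}" if "\<xi> \<in> W" for \<xi>
    using W hol that by (auto simp: analytic_at)
  have reg: "(\<lambda>\<xi>. Q \<xi> / D \<xi>) analytic_on {\<xi>}" if "\<xi> \<in> W" "D \<xi> \<noteq> 0" for \<xi>
    using an[OF that(1)] that(2) by (intro analytic_intros) auto
  have "b analytic_on {\<xi>}" if \<xi>: "\<xi> \<in> W" for \<xi>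
  proof (cases "D \<xi> = 0")
    case False
    then show ?thesis using reg[OF \<xi>] by (simp add: b_def remove_sings_analytic_on)
  next
    case True
    note z = zeros[OF \<xi> True]
    have "isolated_singularity_at (\<lambda>\<xi>. Q \<xi> / D \<xi>) \<xi>"
      by (intro isolated_singularity_at_divide isolated_singularity_at_analytic
          not_essential_analytic an \<xi>)
    moreover have "((\<lambda>w. Q w / D w) \<longlongrightarrow> deriv Q \<xi> / deriv D \<xi>) (at \<xi>)"
    proof -
      have "(Q has_field_derivative deriv Q \<xi>) (at \<xi>)" "(D has_field_derivative deriv D \<xi>) (at \<xi>)"
        using hol W \<xi> by (auto intro: holomorphic_derivI)
      then have "((\<lambda>w. Q w / (w - \<xi>)) \<longlongrightarrow> deriv Q \<xi>) (at \<xi>)" "((\<lambda>w. D w / (w - \<xi>)) \<longlongrightarrow> deriv D \<xi>) (at \<xi>)"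
        using True z by (auto simp: has_field_derivative_iff)
      then have "((\<lambda>w. (Q w / (w - \<xi>)) / (D w / (w - \<xi>))) \<longlongrightarrow> deriv Q \<xi> / deriv D \<xi>) (at \<xi>)"
        using z by (intro tendsto_divide) auto
      then show ?thesis
        by (rule Lim_transform_eventually) (auto simp: eventually_at_filter)
    qed
    ultimately show ?thesis unfolding b_def by (rule remove_sings_analytic_at)
  qed
  then show "b holomorphic_on W"
    by (meson analytic_imp_holomorphic analytic_on_analytic_at)
  show "b \<xi> * D \<xi> = Q \<xi>" if "\<xi> \<in> W" for \<xi>
    using reg[OF that] zeros[OF that] by (cases "D \<xi> = 0") (auto simp: b_def)
qed

lemma holomorphic_on_fps_power_nth:
  assumes "\<And>k. (\<lambda>\<xi>. \<phi> \<xi> $ k) holomorphic_on W"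
  shows "(\<lambda>\<xi>. (\<phi> \<xi> ^ i) $ k) holomorphic_on W"
  by (induction i arbitrary: k) (auto simp: fps_mult_nth intro!: holomorphic_intros assms)

text \<open>A positive modulus that equals its own \<open>n\<close>-th power is 1. Hence every
  resonance lies on the real axis, the only place where linearizability is available.\<close>

lemma multiplier_resonance:
  fixes \<xi> :: complex
  assumes "exp (2 * of_real pi * \<i> * \<xi>) ^ n = exp (2 * of_real pi * \<i> * \<xi>)" "2 \<le> n"
  shows "Im \<xi> = 0"
proof -
  have "norm (exp (2 * of_real pi * \<i> * \<xi>) ^ n) = norm (exp (2 * of_real pi * \<i> * \<xi>))"
    using assms by simp
  then have "exp (real n * (- 2 * pi * Im \<xi>)) = exp (- 2 * pi * Im \<xi>)"
    by (simp add: norm_power norm_exp_eq_Re flip: exp_of_nat_mult)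
  then show ?thesis using assms(2) by simp
qed

text \<open>Each coefficient is a quotient by a small divisor whose zeros are simple and cancelled
  by the numerator. No neighbourhood of a resonance is removed, so one open set \<open>W\<close>
  serves all degrees, although the resonances accumulate as the degree grows.\<close>

lemma holomorphic_formal_linearization:
  fixes F :: "complex \<Rightarrow> complex fps"
  assumes W: "open W" and holF: "\<And>k. (\<lambda>\<xi>. F \<xi> $ k) holomorphic_on W"
    and F0: "\<And>\<xi>. \<xi> \<in> W \<Longrightarrow> F \<xi> $ 0 = 0"
    and F1: "\<And>\<xi>. \<xi> \<in> W \<Longrightarrow> F \<xi> $ 1 = exp (2 * of_real pi * \<i> * \<xi>)"
    and lin: "\<And>\<xi>. \<xi> \<in> W \<Longrightarrow> Im \<xi> = 0 \<Longrightarrow>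
      \<exists>H. H $ 0 = 0 \<and> H $ 1 \<noteq> 0 \<and> F \<xi> oo H = H oo (fps_const (F \<xi> $ 1) * fps_X)"
  obtains \<phi> where "\<And>k. (\<lambda>\<xi>. \<phi> \<xi> $ k) holomorphic_on W"
    "\<And>\<xi>. \<phi> \<xi> $ 0 = 0" "\<And>\<xi>. \<phi> \<xi> $ 1 = 1"
    "\<And>\<xi> m. \<xi> \<in> W \<Longrightarrow> (F \<xi> oo \<phi> \<xi>) $ m = (F \<xi> $ 1) ^ m * \<phi> \<xi> $ m"
proof -
  \<comment> \<open>Stage \<open>n\<close> solves the equation in degrees below
    \<open>n + 2\<close>: the starting series \<open>fps_X\<close> settles degrees 0 and 1, and the
    next coefficient to choose has degree \<open>N = n + 2\<close>.\<close>
  define P where "P n \<phi> \<longleftrightarrow> (\<forall>k. (\<lambda>\<xi>. \<phi> \<xi> $ k) holomorphic_on W) \<and>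
    (\<forall>\<xi>. \<phi> \<xi> $ 0 = 0 \<and> \<phi> \<xi> $ 1 = 1) \<and>
    (\<forall>\<xi>\<in>W. \<forall>m<n + 2. (F \<xi> oo \<phi> \<xi>) $ m = (F \<xi> $ 1) ^ m * \<phi> \<xi> $ m)"
    for n and \<phi> :: "complex \<Rightarrow> complex fps"
  have "\<exists>\<Phi>. \<forall>n. P n (\<Phi> n) \<and> (\<forall>\<xi>. \<forall>m<n + 2. \<Phi> (Suc n) \<xi> $ m = \<Phi> n \<xi> $ m)"
  proof (rule dependent_nat_choice)
    have "P 0 (\<lambda>_. fps_X)"
      unfolding P_def by (auto simp: F0 less_Suc_eq numeral_2_eq_2)
    then show "\<exists>\<phi>. P 0 \<phi>" by blast
  next
    fix \<phi> n assume "P n \<phi>"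
    then have hol: "\<And>k. (\<lambda>\<xi>. \<phi> \<xi> $ k) holomorphic_on W"
      and \<phi>01: "\<And>\<xi>. \<phi> \<xi> $ 0 = 0" "\<And>\<xi>. \<phi> \<xi> $ 1 = 1"
      and eq: "\<And>\<xi> m. \<xi> \<in> W \<Longrightarrow> m < n + 2 \<Longrightarrow> (F \<xi> oo \<phi> \<xi>) $ m = (F \<xi> $ 1) ^ m * \<phi> \<xi> $ m"
      by (auto simp: P_def)
    define N where "N = n + 2"
    define \<mu> :: "complex \<Rightarrow> complex" where "\<mu> = (\<lambda>\<xi>. exp (2 * of_real pi * \<i> * \<xi>))"
    define Q where "Q = (\<lambda>\<xi>. \<Sum>i=2..N. F \<xi> $ i * (\<phi> \<xi> ^ i) $ N)"
    define D where "D = (\<lambda>\<xi>. \<mu> \<xi> ^ N - \<mu> \<xi>)"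
    have "Q holomorphic_on W" "D holomorphic_on W"
      unfolding Q_def D_def \<mu>_def by (intro holomorphic_intros holF holomorphic_on_fps_power_nth hol)+
    moreover have "deriv D \<xi> \<noteq> 0 \<and> Q \<xi> = 0" if \<xi>: "\<xi> \<in> W" "D \<xi> = 0" for \<xi>
    proof
      have res: "\<mu> \<xi> ^ N = \<mu> \<xi>" using \<xi> by (simp add: D_def)
      have "(\<mu> has_field_derivative 2 * of_real pi * \<i> * \<mu> \<xi>) (at \<xi>)"
        unfolding \<mu>_def by (auto intro!: derivative_eq_intros)
      then have "(D has_field_derivative
          of_nat N * \<mu> \<xi> ^ (N - 1) * (2 * of_real pi * \<i> * \<mu> \<xi>) - 2 * of_real pi * \<i> * \<mu> \<xi>) (at \<xi>)"
        unfolding D_def by (auto intro!: derivative_eq_intros)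
      also have "of_nat N * \<mu> \<xi> ^ (N - 1) * (2 * of_real pi * \<i> * \<mu> \<xi>) - 2 * of_real pi * \<i> * \<mu> \<xi>
          = 2 * of_real pi * \<i> * (of_nat N * \<mu> \<xi> ^ N - \<mu> \<xi>)"
        by (simp add: N_def algebra_simps)
      \<comment> \<open>At the resonance \<open>N * \<mu> ^ N - \<mu>\<close> becomes
        \<open>(N - 1) * \<mu>\<close>, and \<open>N - 1 = n + 1\<close> is nonzero: the zero is
        simple.\<close>
      also have "\<dots> = 2 * of_real pi * \<i> * of_nat (n + 1) * \<mu> \<xi>"
        unfolding res by (simp add: N_def algebra_simps)
      finally have "deriv D \<xi> = 2 * of_real pi * \<i> * of_nat (n + 1) * \<mu> \<xi>"
        by (rule DERIV_imp_deriv)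
      then show "deriv D \<xi> \<noteq> 0" by (simp add: \<mu>_def del: of_nat_Suc of_nat_add)
      have "Im \<xi> = 0"
        using multiplier_resonance[of \<xi> N] res by (simp add: \<mu>_def N_def)
      then obtain H where "H $ 0 = 0" "H $ 1 \<noteq> 0" "F \<xi> oo H = H oo (fps_const (\<mu> \<xi>) * fps_X)"
        using lin[OF \<xi>(1)] F1[OF \<xi>(1)] by (auto simp: \<mu>_def)
      \<comment> \<open>At earlier resonances the coefficients of \<open>\<phi> \<xi>\<close> were
        selected by holomorphy, so \<open>\<phi> \<xi>\<close> need not agree with \<open>H\<close>
        in low degrees, even after normalization.\<close>
      then show "Q \<xi> = 0"
        unfolding Q_def using \<phi>01 eq[OF \<xi>(1)] F0[OF \<xi>(1)] F1[OF \<xi>(1)] res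
        by (intro fps_resonance[where H = H and \<mu> = "\<mu> \<xi>"]) (auto simp: \<mu>_def N_def)
    qed
    ultimately obtain b where b: "b holomorphic_on W" "\<And>\<xi>. \<xi> \<in> W \<Longrightarrow> b \<xi> * D \<xi> = Q \<xi>"
      using holomorphic_quotient_simple_zeros[OF W] by metis
    define \<psi> where "\<psi> = (\<lambda>\<xi>. Abs_fps (\<lambda>k. if k = N then b \<xi> else \<phi> \<xi> $ k))"
    have \<psi>\<phi>: "\<psi> \<xi> $ k = \<phi> \<xi> $ k" if "k < N" for \<xi> k using that by (simp add: \<psi>_def)
    have \<psi>01: "\<psi> \<xi> $ 0 = 0" "\<psi> \<xi> $ 1 = 1" for \<xi> using \<phi>01 by (auto simp: \<psi>_def N_def)
    have "(F \<xi> oo \<psi> \<xi>) $ m = (F \<xi> $ 1) ^ m * \<psi> \<xi> $ m" if "\<xi> \<in> W" "m < Suc n + 2" for \<xi> m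
    proof (cases "m = N")
      case False
      then have m: "m < N" using that by (simp add: N_def)
      then have "(F \<xi> oo \<psi> \<xi>) $ m = (F \<xi> oo \<phi> \<xi>) $ m"
        by (intro fps_compose_nth_cong \<psi>\<phi>) auto
      then show ?thesis using eq[OF that(1), of m] m by (simp add: \<psi>\<phi> N_def)
    next
      case True
      have "(\<Sum>i=2..N. F \<xi> $ i * (\<psi> \<xi> ^ i) $ N) = Q \<xi>"
        unfolding Q_def using \<psi>01 \<phi>01 \<psi>\<phi>
        by (intro sum.cong refl arg_cong2[where f="(*)"] fps_power_nth_cong) auto
      then have "(F \<xi> oo \<psi> \<xi>) $ N = \<mu> \<xi> * b \<xi> + Q \<xi>"
        using F1[OF that(1)] by (simp add: fps_compose_nth_split N_def \<mu>_def \<psi>_def)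
      also have "\<dots> = \<mu> \<xi> ^ N * b \<xi>"
        using b(2)[OF that(1)] by (simp add: D_def algebra_simps)
      finally show ?thesis using True F1[OF that(1)] by (simp add: \<mu>_def \<psi>_def)
    qed
    moreover have "(\<lambda>\<xi>. \<psi> \<xi> $ k) holomorphic_on W" for k
      using b hol by (cases "k = N") (auto simp: \<psi>_def)
    ultimately have "P (Suc n) \<psi>" using \<psi>01 by (simp add: P_def)
    then show "\<exists>\<psi>. P (Suc n) \<psi> \<and> (\<forall>\<xi>. \<forall>m<n + 2. \<psi> \<xi> $ m = \<phi> \<xi> $ m)"
      using \<psi>\<phi> by (auto simp: N_def)
  qed
  then obtain \<Phi> where \<Phi>: "\<And>n. P n (\<Phi> n)"
    and step: "\<And>n \<xi> m. m < n + 2 \<Longrightarrow> \<Phi> (Suc n) \<xi> $ m = \<Phi> n \<xi> $ m" by blast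
  have stable: "\<Phi> (n + j) \<xi> $ m = \<Phi> n \<xi> $ m" if "m < n + 2" for n j \<xi> m
    using that by (induction j) (auto simp: step)
  \<comment> \<open>Diagonal limit: later stages do not alter the coefficient of degree
    \<open>m\<close> once stage \<open>m\<close> is reached.\<close>
  define \<phi> where "\<phi> = (\<lambda>\<xi>. Abs_fps (\<lambda>m. \<Phi> m \<xi> $ m))"
  have \<phi>: "\<phi> \<xi> $ k = \<Phi> m \<xi> $ k" if "k \<le> m" for \<xi> k m
    using stable[of k k "m - k" \<xi>] that by (simp add: \<phi>_def)
  show thesis
  proof
    show "(\<lambda>\<xi>. \<phi> \<xi> $ k) holomorphic_on W" for k
      using \<Phi>[of k] by (simp add: \<phi>_def P_def)
    show "\<phi> \<xi> $ 0 = 0" "\<phi> \<xi> $ 1 = 1" for \<xi>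
      using \<Phi>[of 0] \<Phi>[of 1] by (auto simp: \<phi>_def P_def)
    show "(F \<xi> oo \<phi> \<xi>) $ m = (F \<xi> $ 1) ^ m * \<phi> \<xi> $ m" if "\<xi> \<in> W" for \<xi> m
    proof -
      have "(F \<xi> oo \<phi> \<xi>) $ m = (F \<xi> oo \<Phi> m \<xi>) $ m"
        by (intro fps_compose_nth_cong \<phi>)
      then show ?thesis using \<Phi>[of m] that \<phi>[of m m] by (simp add: P_def)
    qed
  qed
qed

section \<open>Double power series\<close>

lemma norm_term_le_of_has_sum:
  fixes c :: "'a \<Rightarrow> complex"
  assumes "(c has_sum S) A"
  obtains M where "M \<ge> 0" "\<And>i. i \<in> A \<Longrightarrow> norm (c i) \<le> M"
proof
  have s: "(\<lambda>i. norm (c i)) summable_on A"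
    using assms summable_on_iff_abs_summable_on_complex has_sum_imp_summable by blast
  show "0 \<le> (\<Sum>\<^sub>\<infinity>i\<in>A. norm (c i))" by (rule infsum_nonneg) auto
  show "norm (c i) \<le> (\<Sum>\<^sub>\<infinity>i\<in>A. norm (c i))" if "i \<in> A" for i
    using finite_sum_le_infsum[OF s, of "{i}"] that by simp
qed

text \<open>The complexification in the parameter: the powers of \<open>x - a\<close> in the double
  series are replaced by powers of a complex \<open>\<xi> - a\<close>, and summing over
  \<open>j\<close> first gives the Taylor coefficients in \<open>z\<close> as holomorphic functions
  of \<open>\<xi>\<close>.\<close>

lemma real_complex_analytic_on_coefficients:
  assumes "real_complex_analytic_on f S" "(a, 0) \<in> S"
  obtains A :: "nat \<Rightarrow> complex \<Rightarrow> complex" and \<rho> M s :: real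
  where "\<rho> > 0" "M \<ge> 0" "s > 0" "\<And>k. A k holomorphic_on ball (of_real a) \<rho>"
    "\<And>k \<xi>. \<xi> \<in> ball (of_real a) \<rho> \<Longrightarrow> norm (A k \<xi>) \<le> M * s ^ k"
    "\<And>x. x \<in> ball a \<rho> \<Longrightarrow> f x has_fps_expansion Abs_fps (\<lambda>k. A k (of_real x))"
proof -
  have "\<exists>c r. r > 0 \<and> (\<forall>x \<in> ball a r. \<forall>z \<in> ball 0 r.
      ((\<lambda>(j, k). c j k * of_real (x - a) ^ j * (z - 0) ^ k) has_sum f x z) UNIV)"
    using bspec[OF assms(1)[unfolded real_complex_analytic_on_def] assms(2)] unfolding prod.case .
  then obtain c r where r: "r > 0" and c: "\<And>x z. x \<in> ball a r \<Longrightarrow> z \<in> ball 0 r \<Longrightarrow>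
      ((\<lambda>(j, k). c j k * of_real (x - a) ^ j * z ^ k) has_sum f x z) UNIV"
    unfolding diff_zero by blast
  \<comment> \<open>Convergence at one point with both increments \<open>r / 2\<close> bounds
    \<open>c j k\<close> by \<open>M * (2 / r) ^ (j + k)\<close>. On the disk of radius
    \<open>r / 4\<close> the series in \<open>j\<close> then has ratio at most 1/2, whence the
    factor 2 in the final bound.\<close>
  have "((\<lambda>(j, k). c j k * of_real (r / 2) ^ j * of_real (r / 2) ^ k)
      has_sum f (a + r / 2) (of_real (r / 2))) UNIV"
    using c[of "a + r / 2" "of_real (r / 2)"] r by (simp add: dist_real_def dist_norm)
  then obtain M where M: "M \<ge> 0"
    "\<And>j k. norm (c j k * of_real (r / 2) ^ j * of_real (r / 2) ^ k) \<le> M"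
    by (rule norm_term_le_of_has_sum) fastforce
  have cM: "norm (c j k) \<le> M * (2 / r) ^ k * (2 / r) ^ j" for j k
    using M(2)[of j k] r by (simp add: norm_mult norm_power norm_divide field_simps)
  define A where "A = (\<lambda>k \<xi>. \<Sum>j. c j k * (\<xi> - of_real a) ^ j)"
  have term_le: "norm (c j k * (\<xi> - of_real a) ^ j) \<le> M * (2 / r) ^ k * (1 / 2) ^ j"
    if "\<xi> \<in> ball (of_real a) (r / 4)" for \<xi> j k
  proof -
    have "norm ((\<xi> - of_real a) ^ j) \<le> (r / 4) ^ j"
      unfolding norm_power using that by (intro power_mono) (auto simp: dist_norm norm_minus_commute)
    then have "norm (c j k * (\<xi> - of_real a) ^ j) \<le> (M * (2 / r) ^ k * (2 / r) ^ j) * (r / 4) ^ j"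
      unfolding norm_mult using cM r M by (intro mult_mono) auto
    also have "\<dots> = M * (2 / r) ^ k * ((2 / r) * (r / 4)) ^ j"
      by (simp only: power_mult_distrib mult.assoc)
    finally show ?thesis using r by simp
  qed
  have geo: "(\<lambda>j. M * (2 / r) ^ k * (1 / 2) ^ j) sums (2 * M * (2 / r) ^ k)" for k
    using sums_mult[OF geometric_sums[of "1 / 2 :: real"], of "M * (2 / r) ^ k"] by (simp add: mult_ac)
  have ns: "summable (\<lambda>j. norm (c j k * (\<xi> - of_real a) ^ j))"
    if "\<xi> \<in> ball (of_real a) (r / 4)" for \<xi> k
    using term_le[OF that] geo[of k] by (intro summable_comparison_test'[OF sums_summable]) auto
  have sumsA: "(\<lambda>j. c j k * (\<xi> - of_real a) ^ j) sums A k \<xi>"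
    if "\<xi> \<in> ball (of_real a) (r / 4)" for \<xi> k
    unfolding A_def by (rule summable_sums[OF summable_norm_cancel[OF ns[OF that]]])
  show thesis
  proof
    show "r / 4 > 0" "2 * M \<ge> 0" "2 / r > 0" using r M by auto
    show "A k holomorphic_on ball (of_real a) (r / 4)" for k
      by (rule power_series_holomorphic[OF sumsA])
    show "norm (A k \<xi>) \<le> 2 * M * (2 / r) ^ k" if "\<xi> \<in> ball (of_real a) (r / 4)" for k \<xi>
      using norm_sums_le[OF sumsA[OF that] geo term_le[OF that]] .
    fix x assume x: "x \<in> ball a (r / 4)"
    then have \<xi>: "of_real x \<in> ball (of_real a :: complex) (r / 4)"
      by (simp add: dist_of_real)
    have "(\<lambda>k. A k (of_real x) * z ^ k) sums f x z" if z: "z \<in> ball 0 r" for z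
    proof -
      have "((\<lambda>(j, k). c j k * of_real (x - a) ^ j * z ^ k) has_sum f x z) (UNIV \<times> UNIV)"
        using c[OF _ z, of x] x r by simp
      then have "((\<lambda>(k, j). c j k * of_real (x - a) ^ j * z ^ k) has_sum f x z) (UNIV \<times> UNIV)"
        by (subst (asm) has_sum_swap) (simp add: case_prod_unfold)
      then have "((\<lambda>k. A k (of_real x) * z ^ k) has_sum f x z) UNIV"
      proof (rule has_sum_SigmaD)
        fix k
        have "((\<lambda>j. c j k * (of_real x - of_real a) ^ j) has_sum A k (of_real x)) UNIV"
          by (rule norm_summable_imp_has_sum[OF ns[OF \<xi>] sumsA[OF \<xi>]])
        from has_sum_cmult_left[OF this, of "z ^ k"]
        show "((\<lambda>j. case (k, j) of (k, j) \<Rightarrow> c j k * of_real (x - a) ^ j * z ^ k)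
            has_sum A k (of_real x) * z ^ k) UNIV"
          by simp
      qed
      then show ?thesis by (rule has_sum_imp_sums)
    qed
    then show "f x has_fps_expansion Abs_fps (\<lambda>k. A k (of_real x))"
      using r by (intro has_fps_expansionI eventually_mono[OF eventually_nhds_in_open[of "ball 0 r"]]) auto
  qed
qed

section \<open>Re-expansion of a power series with holomorphic coefficients\<close>

lemma has_sum_geometric:
  fixes q :: real
  assumes "0 \<le> q" "q < 1"
  shows "((\<lambda>j. q ^ j) has_sum 1 / (1 - q)) UNIV"
  using assms by (intro norm_summable_imp_has_sum geometric_sums) (auto simp: summable_geometric)

lemma summable_on_geometric_product:
  fixes p q B :: real
  assumes "0 \<le> p" "p < 1" "0 \<le> q" "q < 1" "0 \<le> B"
  shows "(\<lambda>(n, j). B * p ^ n * q ^ j) summable_on UNIV \<times> UNIV"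
proof (rule summable_on_SigmaI)
  show "((\<lambda>j. case (n, j) of (n, j) \<Rightarrow> B * p ^ n * q ^ j) has_sum B * p ^ n * (1 / (1 - q))) UNIV" for n
    using has_sum_cmult_right[OF has_sum_geometric[of q], of "B * p ^ n"] assms by simp
  have "((\<lambda>n. B * p ^ n) has_sum B * (1 / (1 - p))) UNIV"
    using has_sum_cmult_right[OF has_sum_geometric[of p], of B] assms by simp
  from has_sum_cmult_left[OF this, of "1 / (1 - q)"]
  show "(\<lambda>n. B * p ^ n * (1 / (1 - q))) summable_on UNIV"
    by (rule has_sum_imp_summable)
qed (use assms in auto)

text \<open>Binomial coefficients vanish beyond \<open>n\<close>, so the sum may run over all
  \<open>k\<close>. This keeps the index sets of the later rearrangements full products.\<close>

lemma has_sum_binomial: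
  fixes u v :: "'a::{comm_ring_1, topological_comm_monoid_add}"
  shows "((\<lambda>k. of_nat (n choose k) * u ^ (n - k) * v ^ k) has_sum (u + v) ^ n) UNIV"
proof -
  have "(u + v) ^ n = (\<Sum>k\<le>n. of_nat (n choose k) * u ^ (n - k) * v ^ k)"
    unfolding add.commute[of u v] binomial_ring by (intro sum.cong) (auto simp: mult_ac)
  then show ?thesis by (intro has_sum_finite_neutralI[of "{..n}"]) (auto simp: binomial_eq_0)
qed

text \<open>An expansion is required around every point, not only around \<open>w = 0\<close>. The
  coefficients are Taylor-expanded at the new real centre with Cauchy estimates,
  \<open>z ^ n\<close> is expanded binomially around \<open>w\<close>, and the resulting triple
  family is absolutely summable, hence can be regrouped.\<close>

lemma real_complex_analytic_on_power_series:
  fixes b :: "nat \<Rightarrow> complex \<Rightarrow> complex"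
  assumes hol: "\<And>n. b n holomorphic_on ball (of_real a) \<rho>"
    and bound: "\<And>n \<xi>. \<xi> \<in> ball (of_real a) \<rho> \<Longrightarrow> norm (b n \<xi>) \<le> B * K ^ n" and K: "K > 0"
  shows "real_complex_analytic_on (\<lambda>x z. \<Sum>n. b n (of_real x) * z ^ n) (ball a \<rho> \<times> ball 0 (1 / K))"
  unfolding real_complex_analytic_on_def
proof safe
  fix a' and w :: complex assume a': "a' \<in> ball a \<rho>" and w: "w \<in> ball 0 (1 / K)"
  \<comment> \<open>\<open>R\<close> keeps a closed disk inside the domain for the Cauchy estimates;
    \<open>r\<close> uses only half of the gap between \<open>norm w\<close> and
    \<open>1 / K\<close>, so that the ratio \<open>K * (norm w + r)\<close> stays below 1.\<close>
  define R where "R = (\<rho> - dist a a') / 2"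
  define r where "r = min R ((1 / K - norm w) / 2)"
  have R: "R > 0" using a' by (simp add: R_def)
  have nw: "norm w < 1 / K" using w by simp
  have r: "r > 0" "r \<le> R" using R nw by (auto simp: r_def)
  have "r \<le> (1 / K - norm w) / 2" unfolding r_def by (rule min.cobounded2)
  then have "norm w + r < 1 / K" using nw by argo
  then have wr: "K * (norm w + r) < 1"
    using K by (simp add: pos_less_divide_eq mult.commute)
  have a'\<rho>: "of_real a' \<in> ball (of_real a :: complex) \<rho>" using a' by (simp add: dist_of_real)
  have B: "B \<ge> 0" using order_trans[OF norm_ge_zero bound[OF a'\<rho>, of 0]] by simp
  have sub: "cball (of_real a') R \<subseteq> ball (of_real a :: complex) \<rho>"
  proof
    fix \<xi> :: complex assume "\<xi> \<in> cball (of_real a') R"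
    then show "\<xi> \<in> ball (of_real a) \<rho>"
      using dist_triangle[of "of_real a" \<xi> "of_real a'"] R
      unfolding R_def mem_ball mem_cball dist_of_real by argo
  qed
  define d where "d n j = (deriv ^^ j) (b n) (of_real a') / fact j" for n j
  have d: "norm (d n j) \<le> B * K ^ n / R ^ j" for n j
  proof -
    have "norm ((deriv ^^ j) (b n) (of_real a')) \<le> fact j * (B * K ^ n) / R ^ j"
    proof (rule Cauchy_inequality)
      show "b n holomorphic_on ball (of_real a') R"
        using hol sub ball_subset_cball by (meson holomorphic_on_subset order_trans)
      show "continuous_on (cball (of_real a') R) (b n)"
        using hol sub by (meson holomorphic_on_subset holomorphic_on_imp_continuous_on)
      show "norm (b n \<xi>) \<le> B * K ^ n" if "norm (of_real a' - \<xi>) = R" for \<xi>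
        using bound[of \<xi> n] sub that by (auto simp: dist_norm)
    qed (use R in auto)
    then show ?thesis by (simp add: d_def norm_divide field_simps)
  qed
  define c where "c j k = (\<Sum>\<^sub>\<infinity>n. d n j * (of_nat (n choose k) * w ^ (n - k)))" for j k
  have c: "((\<lambda>n. d n j * (of_nat (n choose k) * w ^ (n - k))) has_sum c j k) UNIV" for j k
  proof -
    have "(\<lambda>n. norm (d n j * (of_nat (n choose k) * w ^ (n - k)))) summable_on UNIV"
    proof (rule Infinite_Sum.abs_summable_on_comparison_test')
      show "(\<lambda>n. B / R ^ j / r ^ k * (K * (norm w + r)) ^ n) summable_on UNIV"
        using has_sum_geometric[of "K * (norm w + r)"] wr K r
        by (intro summable_on_cmult_right has_sum_imp_summable) auto
      fix n :: nat
      \<comment> \<open>A single term of a binomial sum with nonnegative terms is at most the whole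
        sum; dividing by \<open>r ^ k\<close> leaves a geometric majorant in
        \<open>n\<close>.\<close>
      have "real (n choose k) * norm w ^ (n - k) * r ^ k \<le> (norm w + r) ^ n"
      proof -
        have "(\<Sum>k\<in>{k}. real (n choose k) * norm w ^ (n - k) * r ^ k) \<le> (norm w + r) ^ n"
          using r by (intro finite_sum_le_has_sum[OF has_sum_binomial]) auto
        then show ?thesis by simp
      qed
      then have "real (n choose k) * norm w ^ (n - k) \<le> (norm w + r) ^ n / r ^ k"
        using r by (simp add: field_simps)
      then have "norm (d n j) * (real (n choose k) * norm w ^ (n - k))
          \<le> B * K ^ n / R ^ j * ((norm w + r) ^ n / r ^ k)"
        using d B K R by (intro mult_mono) auto
      then show "norm (d n j * (of_nat (n choose k) * w ^ (n - k)))
          \<le> B / R ^ j / r ^ k * (K * (norm w + r)) ^ n"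
        by (simp add: norm_mult norm_power power_mult_distrib mult_ac)
    qed
    then show ?thesis
      unfolding c_def by (rule has_sum_infsum[OF Infinite_Sum.abs_summable_summable])
  qed
  show "\<exists>c r. r > 0 \<and> (\<forall>x\<in>ball a' r. \<forall>z\<in>ball w r.
      ((\<lambda>(j, k). c j k * of_real (x - a') ^ j * (z - w) ^ k)
        has_sum (\<Sum>n. b n (of_real x) * z ^ n)) UNIV)"
  proof (intro exI[of _ c] exI[of _ r] conjI ballI r)
    fix x z assume x: "x \<in> ball a' r" and z: "z \<in> ball w r"
    define q where "q = \<bar>x - a'\<bar> / R"
    have q: "0 \<le> q" "q < 1" using x r R by (auto simp: q_def dist_real_def)
    define u where "u = norm (z - w)"
    define p where "p = K * (norm w + u)"
    have "p \<le> K * (norm w + r)"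
      unfolding p_def using z K by (intro mult_left_mono) (auto simp: u_def dist_norm norm_minus_commute)
    then have "p < 1" using wr by linarith
    moreover have "0 \<le> p" using K by (simp add: p_def u_def)
    ultimately have p: "0 \<le> p" "p < 1" by blast+
    have "norm z \<le> norm w + u" unfolding u_def using norm_triangle_ineq[of w "z - w"] by simp
    then have Kz: "K * norm z \<le> p" using K by (simp add: p_def)
    have x\<rho>: "of_real x \<in> ball (of_real a' :: complex) R" using x r by (simp add: dist_of_real)
    then have xa: "of_real x \<in> ball (of_real a :: complex) \<rho>"
      using sub ball_subset_cball by blast
    have dj: "norm (d n j * of_real (x - a') ^ j) \<le> B * K ^ n * q ^ j" for n j
    proof -
      have "norm (d n j * of_real (x - a') ^ j) \<le> B * K ^ n / R ^ j * \<bar>x - a'\<bar> ^ j"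
        unfolding norm_mult norm_power norm_of_real by (intro mult_right_mono d) auto
      then show ?thesis by (simp add: q_def power_divide)
    qed
    have bsum: "((\<lambda>j. d n j * of_real (x - a') ^ j) has_sum b n (of_real x)) UNIV" for n
    proof (rule norm_summable_imp_has_sum)
      show "summable (\<lambda>j. norm (d n j * of_real (x - a') ^ j))"
        using dj q by (intro summable_comparison_test'[OF summable_mult[OF summable_geometric[of q]]]) auto
      have "b n holomorphic_on ball (of_real a') R"
        using hol sub ball_subset_cball by (meson holomorphic_on_subset order_trans)
      from holomorphic_power_series[OF this x\<rho>]
      show "(\<lambda>j. d n j * of_real (x - a') ^ j) sums b n (of_real x)" by (simp add: d_def)
    qed
    define E where "E = (\<lambda>(n, j). d n j * of_real (x - a') ^ j * z ^ n)"
    have "(\<lambda>i. norm (E i)) summable_on UNIV \<times> UNIV"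
    proof (rule Infinite_Sum.abs_summable_on_comparison_test'[OF summable_on_geometric_product[OF p q B]], clarify)
      fix n j
      have "norm (E (n, j)) \<le> B * K ^ n * q ^ j * norm z ^ n"
        unfolding E_def using dj[of n j] by (simp add: norm_mult norm_power mult_right_mono)
      also have "\<dots> = B * (K * norm z) ^ n * q ^ j" by (simp add: power_mult_distrib)
      also have "\<dots> \<le> B * p ^ n * q ^ j"
        using B q K Kz by (intro mult_right_mono mult_left_mono power_mono) auto
      finally show "norm (E (n, j)) \<le> B * p ^ n * q ^ j" .
    qed
    then have Es: "E summable_on UNIV \<times> UNIV" by (rule Infinite_Sum.abs_summable_summable)
    have bz: "((\<lambda>n. b n (of_real x) * z ^ n) has_sum (\<Sum>n. b n (of_real x) * z ^ n)) UNIV"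
    proof -
      have "summable (\<lambda>n. norm (b n (of_real x) * z ^ n))"
      proof (rule summable_comparison_test'[OF summable_mult[OF summable_geometric[of p]]])
        show "norm (norm (b n (of_real x) * z ^ n)) \<le> B * p ^ n" for n
        proof -
          have "norm (b n (of_real x) * z ^ n) \<le> B * K ^ n * norm z ^ n"
            using bound[OF xa, of n] by (auto simp: norm_mult norm_power intro!: mult_right_mono)
          also have "\<dots> = B * (K * norm z) ^ n" by (simp add: power_mult_distrib)
          also have "\<dots> \<le> B * p ^ n" using B K Kz by (intro mult_left_mono power_mono) auto
          finally show ?thesis by simp
        qed
      qed (use p in auto)
      then show ?thesis
        by (intro norm_summable_imp_has_sum summable_sums) (auto dest: summable_norm_cancel)
    qed
    have E: "(E has_sum (\<Sum>n. b n (of_real x) * z ^ n)) (UNIV \<times> UNIV)"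
    proof (rule has_sum_SigmaI[OF _ bz Es])
      show "((\<lambda>j. E (n, j)) has_sum b n (of_real x) * z ^ n) UNIV" for n
        unfolding E_def using has_sum_cmult_left[OF bsum] by simp
    qed
    define T where "T = (\<lambda>((n, j), k). d n j * of_real (x - a') ^ j *
      (of_nat (n choose k) * w ^ (n - k) * (z - w) ^ k))"
    \<comment> \<open>Majorant of \<open>T\<close>: summing over \<open>k\<close> turns the binomial
      terms into \<open>(norm w + u) ^ n\<close>, leaving the product of geometric series with
      ratios \<open>p\<close> and \<open>q\<close>.\<close>
    define g where "g = (\<lambda>((n, j), k). B * K ^ n * q ^ j *
      (real (n choose k) * norm w ^ (n - k) * u ^ k))"
    have "g summable_on (UNIV \<times> UNIV) \<times> UNIV"
    proof (rule summable_on_SigmaI)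
      show "((\<lambda>k. g (i, k)) has_sum (case i of (n, j) \<Rightarrow> B * p ^ n * q ^ j)) UNIV" for i
      proof (cases i)
        case (Pair n j)
        have "((\<lambda>k. g (i, k)) has_sum B * K ^ n * q ^ j * (norm w + u) ^ n) UNIV"
          unfolding g_def Pair prod.case by (intro has_sum_cmult_right has_sum_binomial)
        then show ?thesis by (simp add: Pair p_def power_mult_distrib mult_ac)
      qed
      show "(\<lambda>(n, j). B * p ^ n * q ^ j) summable_on UNIV \<times> UNIV"
        by (rule summable_on_geometric_product[OF p q B])
      show "0 \<le> g (i, k)" for i k
        using B K q by (cases i) (auto simp: g_def u_def)
    qed
    then have "(\<lambda>i. norm (T i)) summable_on (UNIV \<times> UNIV) \<times> UNIV"
    proof (rule Infinite_Sum.abs_summable_on_comparison_test', clarify)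
      fix n j k
      show "norm (T ((n, j), k)) \<le> g ((n, j), k)"
        unfolding T_def g_def prod.case norm_mult[of "d n j * _"] u_def
        using dj[of n j] B K q by (intro mult_mono) (auto simp: norm_mult norm_power)
    qed
    then have Ts: "T summable_on (UNIV \<times> UNIV) \<times> UNIV" by (rule Infinite_Sum.abs_summable_summable)
    have "(T has_sum (\<Sum>n. b n (of_real x) * z ^ n)) ((UNIV \<times> UNIV) \<times> UNIV)"
    proof (rule has_sum_SigmaI[OF _ E Ts])
      fix i :: "nat \<times> nat"
      obtain n j where i: "i = (n, j)" by fastforce
      have "((\<lambda>k. T (i, k)) has_sum d n j * of_real (x - a') ^ j * (w + (z - w)) ^ n) UNIV"
        unfolding T_def i prod.case by (intro has_sum_cmult_right has_sum_binomial)
      then show "((\<lambda>k. T (i, k)) has_sum E i) UNIV" by (simp add: E_def i)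
    qed
    \<comment> \<open>The same family with \<open>n\<close> as the innermost index, so that summing
      it out produces \<open>c j k\<close>.\<close>
    then have "((\<lambda>((j, k), n). T ((n, j), k)) has_sum (\<Sum>n. b n (of_real x) * z ^ n))
        ((UNIV \<times> UNIV) \<times> UNIV)"
      by (subst has_sum_reindex_bij_witness[where i = "\<lambda>((n, j), k). ((j, k), n)"
            and j = "\<lambda>((j, k), n). ((n, j), k)" and h = T and T = "(UNIV \<times> UNIV) \<times> UNIV"]) auto
    then have "((\<lambda>(j, k). c j k * of_real (x - a') ^ j * (z - w) ^ k)
        has_sum (\<Sum>n. b n (of_real x) * z ^ n)) (UNIV \<times> UNIV)"
    proof (rule has_sum_SigmaD)
      fix i :: "nat \<times> nat"
      obtain j k where i: "i = (j, k)" by fastforce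
      have "((\<lambda>n. d n j * (of_nat (n choose k) * w ^ (n - k)) * (of_real (x - a') ^ j * (z - w) ^ k))
          has_sum c j k * (of_real (x - a') ^ j * (z - w) ^ k)) UNIV"
        by (rule has_sum_cmult_left[OF c])
      then show "((\<lambda>n. (\<lambda>((j, k), n). T ((n, j), k)) (i, n)) has_sum
          (\<lambda>(j, k). c j k * of_real (x - a') ^ j * (z - w) ^ k) i) UNIV"
        by (simp add: i T_def mult_ac)
    qed
    then show "((\<lambda>(j, k). c j k * of_real (x - a') ^ j * (z - w) ^ k)
        has_sum (\<Sum>n. b n (of_real x) * z ^ n)) UNIV" by simp
  qed
qed

section \<open>Linearizable germs\<close>

text \<open>A homeomorphism is injective, and an injective holomorphic map has nonvanishing
  derivative; this gives \<open>H $ 1 \<noteq> 0\<close>. The germ identity then passes to Taylor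
  series by uniqueness.\<close>

lemma linearizable_imp_formal_linearization:
  assumes "linearizable g \<alpha>" "g has_fps_expansion F" "F $ 0 = 0"
  shows "\<exists>H. H $ 0 = 0 \<and> H $ 1 \<noteq> 0 \<and>
    F oo H = H oo (fps_const (exp (2 * of_real pi * \<i> * of_real \<alpha>)) * fps_X)"
proof -
  obtain h k U V where U: "open U" "0 \<in> U" and h: "h holomorphic_on U" "homeomorphism U V h k" "h 0 = 0"
    and conj: "\<forall>\<^sub>F z in nhds 0. h (rot \<alpha> z) = g (h z)"
    using assms(1) unfolding linearizable_def by blast
  define H where "H = fps_expansion h 0"
  define \<mu> where "\<mu> = exp (2 * of_real pi * \<i> * complex_of_real \<alpha>)"
  have eH: "h has_fps_expansion H" unfolding H_def using U h by blast
  have "inj_on h U" using h(2) by (metis homeomorphism_def inj_on_inverseI)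
  then have "deriv h 0 \<noteq> 0" using holomorphic_injective_imp_regular h U by blast
  then have H01: "H $ 0 = 0" "H $ 1 \<noteq> 0"
    using fps_nth_fps_expansion[OF eH, of 0] fps_nth_fps_expansion[OF eH, of 1] h by auto
  have "(g \<circ> h) has_fps_expansion (F oo H)"
    by (rule has_fps_expansion_compose[OF assms(2) eH H01(1)])
  moreover have "(h \<circ> (\<lambda>z. \<mu> * z)) has_fps_expansion (H oo (fps_const \<mu> * fps_X))"
    by (intro has_fps_expansion_compose eH fps_expansion_intros) auto
  moreover have "\<forall>\<^sub>F z in nhds 0. (g \<circ> h) z = (h \<circ> (\<lambda>z. \<mu> * z)) z"
    using conj by eventually_elim (simp add: rot_def \<mu>_def)
  ultimately have "F oo H = H oo (fps_const \<mu> * fps_X)"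
    using fps_expansion_unique_complex has_fps_expansion_cong by blast
  then show ?thesis using H01 unfolding \<mu>_def by blast
qed

text \<open>At the centre \<open>x = a\<close> of a local expansion only the terms with
  \<open>j = 0\<close> survive (with \<open>0 ^ 0 = 1\<close>), leaving an ordinary power series in
  \<open>z - w\<close>.\<close>

lemma real_complex_analytic_on_imp_holomorphic:
  assumes F: "real_complex_analytic_on F S" and T: "open T" "\<And>w. w \<in> T \<Longrightarrow> (a, w) \<in> S"
  shows "F a holomorphic_on T"
proof -
  have "F a analytic_on {w}" if w: "w \<in> T" for w
  proof -
    obtain c r where r: "r > 0" and c: "\<And>x z. x \<in> ball a r \<Longrightarrow> z \<in> ball w r \<Longrightarrow>
        ((\<lambda>(j, k). c j k * of_real (x - a) ^ j * (z - w) ^ k) has_sum F x z) UNIV"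
      using F T(2)[OF w] unfolding real_complex_analytic_on_def by blast
    have "(\<lambda>k. c 0 k * (z - w) ^ k) sums F a z" if "z \<in> ball w r" for z
    proof -
      have "((\<lambda>(j, k). c j k * of_real (a - a) ^ j * (z - w) ^ k) has_sum F a z) UNIV"
        using that r by (intro c) auto
      then have "((\<lambda>(j, k). c j k * of_real (a - a) ^ j * (z - w) ^ k) has_sum F a z) (range (Pair 0))"
        by (rule has_sum_cong_neutral[THEN iffD1, rotated -1]) (auto simp: image_iff power_0_left)
      then have "((\<lambda>k. c 0 k * (z - w) ^ k) has_sum F a z) UNIV"
        by (subst (asm) has_sum_reindex) (auto simp: inj_on_def o_def)
      then show ?thesis by (rule has_sum_imp_sums)
    qed
    then have "F a holomorphic_on ball w r" by (rule power_series_holomorphic)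
    then show ?thesis unfolding analytic_at using r by (intro exI[of _ "ball w r"]) auto
  qed
  then show ?thesis by (meson analytic_imp_holomorphic analytic_on_analytic_at)
qed

lemma tangent_to_identity_of_bigo:
  fixes \<phi> :: "complex \<Rightarrow> complex"
  assumes "(\<lambda>z. \<phi> z - z) \<in> O[nhds 0](\<lambda>z. z ^ 2)"
  shows "\<phi> 0 = 0" "(\<phi> has_field_derivative 1) (at 0)"
proof -
  obtain c where c: "c > 0" "\<forall>\<^sub>F z in nhds 0. norm (\<phi> z - z) \<le> c * norm (z ^ 2)"
    using assms by (elim landau_o.bigE)
  \<comment> \<open>Unlike \<open>at 0\<close>, the filter \<open>nhds 0\<close> includes the point
    0 itself, where the right-hand side of the estimate vanishes.\<close>
  show \<phi>0: "\<phi> 0 = 0" using eventually_nhds_x_imp_x[OF c(2)] by simp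
  have "((\<lambda>z. \<phi> z / z - 1) \<longlongrightarrow> 0) (at 0)"
  proof (rule Lim_null_comparison)
    have "\<forall>\<^sub>F z in at 0. norm (\<phi> z - z) \<le> c * norm (z ^ 2)"
      using c(2) by (simp add: eventually_at_filter eventually_mono)
    moreover have "\<forall>\<^sub>F z::complex in at 0. z \<noteq> 0" by (rule eventually_neq_at_within)
    ultimately show "\<forall>\<^sub>F z in at 0. norm (\<phi> z / z - 1) \<le> c * norm z"
    proof eventually_elim
      case (elim z)
      have "norm (\<phi> z / z - 1) = norm (\<phi> z - z) / norm z"
        using elim(2) by (simp add: diff_divide_distrib flip: norm_divide)
      also have "\<dots> \<le> c * norm (z ^ 2) / norm z" by (intro divide_right_mono elim) auto
      also have "\<dots> = c * norm z" using elim(2) by (simp add: norm_mult power2_eq_square)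
      finally show ?case .
    qed
    show "((\<lambda>z::complex. c * norm z) \<longlongrightarrow> 0) (at 0)" by (auto intro!: tendsto_eq_intros)
  qed
  then have "((\<lambda>z. \<phi> z / z) \<longlongrightarrow> 1) (at 0)" by (simp add: LIM_zero_iff)
  then show "(\<phi> has_field_derivative 1) (at 0)" unfolding has_field_derivative_iff \<phi>0 diff_zero .
qed

lemma linearizableI:
  assumes hol: "\<phi> holomorphic_on ball 0 \<delta>" "\<delta> > 0" and 0: "\<phi> 0 = 0" "deriv \<phi> 0 \<noteq> 0"
    and conj: "\<And>z. z \<in> ball 0 \<delta> \<Longrightarrow> \<phi> (rot \<alpha> z) = g (\<phi> z)"
  shows "linearizable g \<alpha>"
proof -
  have "0 \<in> ball (0::complex) \<delta>" using hol(2) by simp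
  then obtain r where r: "r > 0" "ball (0::complex) r \<subseteq> ball 0 \<delta>" "open (\<phi> ` ball 0 r)" "inj_on \<phi> (ball 0 r)"
    by (rule has_complex_derivative_locally_invertible[OF hol(1) _ open_ball 0(2)]) (rule that)
  have h: "\<phi> holomorphic_on ball 0 r" using hol r by (blast intro: holomorphic_on_subset)
  obtain k where k: "k holomorphic_on \<phi> ` ball 0 r" "\<And>z. z \<in> ball 0 r \<Longrightarrow> k (\<phi> z) = z"
    using holomorphic_has_inverse[OF h open_ball r(4)] by metis
  have "homeomorphism (ball 0 r) (\<phi> ` ball 0 r) \<phi> k"
    using h k by (intro homeomorphismI holomorphic_on_imp_continuous_on) auto
  moreover have "0 \<in> \<phi> ` ball 0 r" using 0 r by force
  moreover have "\<forall>\<^sub>F z in nhds 0. \<phi> (rot \<alpha> z) = g (\<phi> z)"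
    using eventually_nhds_in_open[OF open_ball \<open>0 \<in> ball 0 \<delta>\<close>] by (rule eventually_mono) (rule conj)
  ultimately show ?thesis
    unfolding linearizable_def using h k(1) r 0
    by (intro exI[of _ \<phi>] exI[of _ k] exI[of _ "ball 0 r"] exI[of _ "\<phi> ` ball 0 r"]) auto
qed

section \<open>From pointwise linearizability to uniform coefficient bounds\<close>

lemma local_analytic_linearization:
  assumes an: "real_complex_analytic_on f (I \<times> ball 0 1)"
    and f0: "\<And>\<alpha>. \<alpha> \<in> I \<Longrightarrow> f \<alpha> 0 = 0"
    and f1: "\<And>\<alpha>. \<alpha> \<in> I \<Longrightarrow> deriv (f \<alpha>) 0 = exp (2 * of_real pi * \<i> * of_real \<alpha>)"
    and x: "e > 0" "ball x e \<subseteq> I" and lin: "\<And>\<alpha>. \<alpha> \<in> ball x e \<Longrightarrow> linearizable (f \<alpha>) \<alpha>"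
  obtains b :: "nat \<Rightarrow> complex \<Rightarrow> complex" and F \<rho> K
  where "0 < \<rho>" "\<rho> \<le> e" "K > 0" "\<And>n. b n holomorphic_on ball (of_real x) \<rho>"
    "\<And>\<xi>. b 0 \<xi> = 0" "\<And>\<xi>. b 1 \<xi> = 1"
    "\<And>n \<xi>. \<xi> \<in> ball (of_real x) \<rho> \<Longrightarrow> norm (b (Suc n) \<xi>) \<le> 2 * K ^ n"
    "\<And>\<alpha>. \<alpha> \<in> ball x \<rho> \<Longrightarrow> f \<alpha> has_fps_expansion F \<alpha>"
    "\<And>\<alpha>. \<alpha> \<in> ball x \<rho> \<Longrightarrow> F \<alpha> oo Abs_fps (\<lambda>n. b n (of_real \<alpha>)) =
       Abs_fps (\<lambda>n. b n (of_real \<alpha>)) oo (fps_const (exp (2 * of_real pi * \<i> * of_real \<alpha>)) * fps_X)"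
proof -
  have x0: "(x, 0) \<in> I \<times> ball (0::complex) 1" using x by auto
  obtain A \<rho>0 M s where A: "\<rho>0 > 0" "M \<ge> 0" "s > 0"
      "\<And>k. A k holomorphic_on ball (of_real x) \<rho>0"
      "\<And>k \<xi>. \<xi> \<in> ball (of_real x) \<rho>0 \<Longrightarrow> norm (A k \<xi>) \<le> M * s ^ k"
      "\<And>\<alpha>. \<alpha> \<in> ball x \<rho>0 \<Longrightarrow> f \<alpha> has_fps_expansion Abs_fps (\<lambda>k. A k (of_real \<alpha>))"
    by (rule real_complex_analytic_on_coefficients[OF an x0]) (rule that)
  \<comment> \<open>The bound 1 ensures \<open>\<bar>Im \<xi>\<bar> \<le> 1\<close> on
    \<open>W\<close>, as the multiplier gap requires.\<close>
  define \<rho> where "\<rho> = min (min \<rho>0 e) 1"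
  have \<rho>: "\<rho> > 0" "\<rho> \<le> \<rho>0" "\<rho> \<le> e" "\<rho> \<le> 1" using A x by (auto simp: \<rho>_def)
  define W where "W = ball (complex_of_real x) \<rho>"
  have W: "open W" "W \<subseteq> ball (of_real x) \<rho>0" using \<rho> by (auto simp: W_def)
  define \<mu> :: "complex \<Rightarrow> complex" where "\<mu> = (\<lambda>\<xi>. exp (2 * of_real pi * \<i> * \<xi>))"
  \<comment> \<open>The hypotheses on \<open>f\<close> fix the first two coefficients only at real
    parameters; prescribing them on all of \<open>W\<close> agrees with \<open>A\<close>
    there.\<close>
  define F where "F = (\<lambda>\<xi>. Abs_fps (\<lambda>k. if k = 0 then 0 else if k = 1 then \<mu> \<xi> else A k \<xi>))"
  have F01: "F \<xi> $ 0 = 0" "F \<xi> $ 1 = \<mu> \<xi>" for \<xi> by (auto simp: F_def)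
  have FA: "norm (F \<xi> $ k) \<le> M * s ^ k" if "\<xi> \<in> W" "2 \<le> k" for \<xi> k
    using A(5)[of \<xi> k] W that by (auto simp: F_def)
  have expF: "f \<alpha> has_fps_expansion F (of_real \<alpha>)" if \<alpha>: "\<alpha> \<in> ball x \<rho>" for \<alpha>
  proof -
    have \<alpha>I: "\<alpha> \<in> I" "\<alpha> \<in> ball x \<rho>0" using \<alpha> \<rho> x by auto
    note ex = A(6)[OF \<alpha>I(2)]
    have "A 0 (of_real \<alpha>) = 0" "A 1 (of_real \<alpha>) = \<mu> (of_real \<alpha>)"
      using fps_nth_fps_expansion[OF ex, of 0] fps_nth_fps_expansion[OF ex, of 1]
        f0[OF \<alpha>I(1)] f1[OF \<alpha>I(1)] by (auto simp: \<mu>_def)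
    then have "Abs_fps (\<lambda>k. A k (of_real \<alpha>)) = F (of_real \<alpha>)" by (auto simp: F_def fps_eq_iff)
    then show ?thesis using ex by simp
  qed
  obtain \<phi> where hol: "\<And>k. (\<lambda>\<xi>. \<phi> \<xi> $ k) holomorphic_on W"
    and \<phi>: "\<And>\<xi>. \<phi> \<xi> $ 0 = 0" "\<And>\<xi>. \<phi> \<xi> $ 1 = 1"
      "\<And>\<xi> m. \<xi> \<in> W \<Longrightarrow> (F \<xi> oo \<phi> \<xi>) $ m = (F \<xi> $ 1) ^ m * \<phi> \<xi> $ m"
  proof (rule holomorphic_formal_linearization[OF W(1), of F])
    show "(\<lambda>\<xi>. F \<xi> $ k) holomorphic_on W" for k
    proof (cases "k = 0 \<or> k = 1")
      case True
      then show ?thesis by (auto simp: F_def \<mu>_def intro!: holomorphic_intros)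
    next
      case False
      then show ?thesis using holomorphic_on_subset[OF A(4) W(2)] by (simp add: F_def)
    qed
    show "F \<xi> $ 0 = 0" for \<xi> by (rule F01)
    show "F \<xi> $ 1 = exp (2 * of_real pi * \<i> * \<xi>)" for \<xi> by (simp add: F_def \<mu>_def)
    fix \<xi> assume \<xi>: "\<xi> \<in> W" "Im \<xi> = 0"
    then have re: "\<xi> = of_real (Re \<xi>)" by (simp add: complex_eq_iff)
    then have R: "Re \<xi> \<in> ball x \<rho>" using \<xi> by (metis W_def dist_of_real mem_ball)
    then have "linearizable (f (Re \<xi>)) (Re \<xi>)" using lin \<rho> by auto
    from linearizable_imp_formal_linearization[OF this expF[OF R] F01(1)]
    show "\<exists>H. H $ 0 = 0 \<and> H $ 1 \<noteq> 0 \<and> F \<xi> oo H = H oo (fps_const (F \<xi> $ 1) * fps_X)"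
      unfolding F01 \<mu>_def using re by simp
  qed (use that in blast)
  \<comment> \<open>Chosen so that \<open>t = \<kappa> * y\<close> and
    \<open>\<epsilon> = exp (- 4 * pi) * y\<close>, with \<open>y = \<bar>Im \<xi>\<bar>\<close>,
    meet both conditions of the majorant lemma. The added 1 keeps the denominator positive when
    \<open>M = 0\<close>.\<close>
  define \<kappa> where "\<kappa> = min (1 / (4 * s)) (exp (- 4 * pi) / (8 * M * s\<^sup>2 + 1))"
  have Ms: "8 * M * s\<^sup>2 \<ge> 0" using A by simp
  then have "8 * M * s\<^sup>2 + 1 > 0" by linarith
  then have \<kappa>: "\<kappa> > 0" using A by (auto simp: \<kappa>_def intro!: divide_pos_pos)
  have "\<kappa> \<le> 1 / (4 * s)" by (simp add: \<kappa>_def)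
  then have \<kappa>s: "4 * s * \<kappa> \<le> 1" using A(3) by (simp add: field_simps)
  have \<kappa>M: "8 * M * s\<^sup>2 * \<kappa> \<le> exp (- 4 * pi)"
  proof -
    have "\<kappa> \<le> exp (- 4 * pi) / (8 * M * s\<^sup>2 + 1)" by (simp add: \<kappa>_def)
    then have "\<kappa> * (8 * M * s\<^sup>2 + 1) \<le> exp (- 4 * pi)" using Ms by (simp add: pos_le_divide_eq)
    then show ?thesis using \<kappa> by (simp add: algebra_simps)
  qed
  have bd: "norm (\<phi> \<xi> $ Suc m) * \<bar>Im \<xi>\<bar> ^ m \<le> 2 / \<kappa> ^ m" if \<xi>: "\<xi> \<in> W" for \<xi> m
  proof (cases "m = 0 \<or> Im \<xi> = 0")
    case True
    then show ?thesis using \<phi>(2)[of \<xi>] \<kappa> by (cases "m = 0") (auto simp: zero_power)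
  next
    case False
    define y where "y = \<bar>Im \<xi>\<bar>"
    have "y = \<bar>Im (\<xi> - of_real x)\<bar>" by (simp add: y_def)
    also have "\<dots> \<le> norm (\<xi> - of_real x)" by (rule abs_Im_le_cmod)
    finally have y: "y > 0" "y \<le> 1"
      using \<xi> \<rho> False by (auto simp: W_def dist_norm norm_minus_commute y_def)
    have "norm (\<phi> \<xi> $ Suc m) * (\<kappa> * y) ^ Suc m \<le> 2 * (\<kappa> * y)"
    proof (rule linearization_majorant[where F = "F \<xi>" and \<mu> = "\<mu> \<xi>" and M = M and s = s
          and \<epsilon> = "exp (- 4 * pi) * y"])
      show "(F \<xi> oo \<phi> \<xi>) $ n = \<mu> \<xi> ^ n * \<phi> \<xi> $ n" for n using \<phi>(3)[OF \<xi>] F01 by simp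
      show "exp (- 4 * pi) * y \<le> norm (\<mu> \<xi> ^ n - \<mu> \<xi>)" if "2 \<le> n" for n
        using multiplier_gap[OF _ that, of \<xi>] y by (simp add: y_def \<mu>_def)
      show "4 * s * (\<kappa> * y) \<le> 1"
        using mult_mono[OF \<kappa>s y(2)] y A \<kappa> by (simp add: mult_ac)
      show "8 * M * s\<^sup>2 * (\<kappa> * y) \<le> exp (- 4 * pi) * y"
        using mult_right_mono[OF \<kappa>M, of y] y by (simp add: mult_ac)
    qed (use \<phi> F01 FA \<xi> A \<kappa> y in auto)
    \<comment> \<open>One factor \<open>t\<close> cancels, so degree \<open>Suc m\<close> blows up
      only like the \<open>m\<close>-th power of \<open>1 / y\<close>.\<close>
    then have "(norm (\<phi> \<xi> $ Suc m) * (\<kappa> * y) ^ m) * (\<kappa> * y) \<le> 2 * (\<kappa> * y)"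
      by (simp add: mult_ac)
    then have "norm (\<phi> \<xi> $ Suc m) * (\<kappa> * y) ^ m \<le> 2"
      using \<kappa> y by (subst (asm) mult_le_cancel_right_pos) auto
    then show ?thesis
      using \<kappa> by (simp add: y_def[symmetric] power_mult_distrib pos_le_divide_eq mult_ac)
  qed
  \<comment> \<open>The circle used has radius \<open>\<rho> / 2\<close>, strictly inside
    \<open>W\<close>: the factor \<open>8 / (3 * (\<rho> / 2))\<close> arises from it, and the bound
    holds on the disk of radius \<open>\<rho> / 4\<close>.\<close>
  define K where "K = 16 / (3 * \<rho>) / \<kappa>"
  have bK: "norm (\<phi> \<xi> $ Suc m) \<le> 2 * K ^ m" if \<xi>: "\<xi> \<in> ball (of_real x) (\<rho> / 4)" for \<xi> m
  proof -
    have "norm (\<phi> \<xi> $ Suc m) \<le> 2 / \<kappa> ^ m * (8 / (3 * (\<rho> / 2))) ^ m"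
    proof (rule holomorphic_bound_across_real_axis[where R = \<rho> and g = "\<lambda>\<xi>. \<phi> \<xi> $ Suc m" and \<xi> = \<xi>])
      show "(\<lambda>\<xi>. \<phi> \<xi> $ Suc m) holomorphic_on ball (of_real x) \<rho>" using hol by (simp add: W_def)
      show "norm (\<phi> \<xi> $ Suc m) * \<bar>Im \<xi>\<bar> ^ m \<le> 2 / \<kappa> ^ m" if "\<xi> \<in> sphere (of_real x) (\<rho> / 2)" for \<xi>
        using that \<rho> by (intro bd) (auto simp: W_def)
      show "\<xi> \<in> cball (of_real x) (\<rho> / 2 / 2)" using \<xi> by simp
    qed (use \<rho> in auto)
    also have "\<dots> = 2 * K ^ m" by (simp add: K_def power_divide power_mult_distrib)
    finally show ?thesis .
  qed
  show thesis
  proof (rule that[of "\<rho> / 4" K "\<lambda>n \<xi>. \<phi> \<xi> $ n" "\<lambda>\<alpha>. F (of_real \<alpha>)"])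
    show "0 < \<rho> / 4" "\<rho> / 4 \<le> e" "K > 0" using \<rho> \<kappa> by (auto simp: K_def)
    show "(\<lambda>\<xi>. \<phi> \<xi> $ n) holomorphic_on ball (of_real x) (\<rho> / 4)" for n
      by (rule holomorphic_on_subset[OF hol]) (use \<rho> in \<open>auto simp: W_def\<close>)
    show "\<phi> \<xi> $ 0 = 0" "\<phi> \<xi> $ 1 = 1" for \<xi> by (rule \<phi>)+
    show "norm (\<phi> \<xi> $ Suc n) \<le> 2 * K ^ n" if "\<xi> \<in> ball (of_real x) (\<rho> / 4)" for \<xi> n
      using bK[OF that] .
    fix \<alpha> assume "\<alpha> \<in> ball x (\<rho> / 4)"
    then have \<alpha>: "\<alpha> \<in> ball x \<rho>" using \<rho> by auto
    then have "of_real \<alpha> \<in> W" by (simp add: W_def dist_of_real)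
    from \<phi>(3)[OF this]
    show "F (of_real \<alpha>) oo Abs_fps (\<lambda>n. \<phi> (of_real \<alpha>) $ n) = Abs_fps (\<lambda>n. \<phi> (of_real \<alpha>) $ n) oo
        (fps_const (exp (2 * of_real pi * \<i> * of_real \<alpha>)) * fps_X)"
      unfolding F01 by (simp add: fps_eq_iff fps_compose_linear fps_nth_inverse \<mu>_def)
    show "f \<alpha> has_fps_expansion F (of_real \<alpha>)" by (rule expF[OF \<alpha>])
  qed
qed

section \<open>From the formal conjugacy to the actual one\<close>

text \<open>With \<open>K * norm z < 1 / 2\<close> the geometric majorant sums to at most 2. The
  second bound will keep the values of the conjugacy in the unit disk; the third gives tangency to
  the identity.\<close>

lemma normalized_power_series_bounds:
  fixes b :: "nat \<Rightarrow> complex"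
  assumes b: "b 0 = 0" "b 1 = 1" "\<And>n. norm (b (Suc n)) \<le> 2 * K ^ n" and K: "K > 0"
    and z: "norm z < 1 / (2 * K)"
  shows "summable (\<lambda>n. b n * z ^ n)" "norm (\<Sum>n. b n * z ^ n) \<le> 4 * norm z"
    "norm ((\<Sum>n. b n * z ^ n) - z) \<le> 4 * K * norm (z\<^sup>2)"
proof -
  have Kz: "K * norm z < 1 / 2" using z K by (simp add: field_simps)
  have g: "(\<lambda>n. (K * norm z) ^ n) sums (1 / (1 - K * norm z))"
    using Kz K by (intro geometric_sums) simp
  have g2: "1 / (1 - K * norm z) \<le> 2" using Kz by (simp add: field_simps)
  have term_le: "norm (b (Suc n) * z ^ Suc n) \<le> 2 * norm z * (K * norm z) ^ n" for n
  proof -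
    have "norm (b (Suc n) * z ^ Suc n) \<le> 2 * K ^ n * norm z ^ Suc n"
      unfolding norm_mult norm_power by (intro mult_right_mono b) auto
    then show ?thesis by (simp add: power_mult_distrib mult_ac)
  qed
  have s1: "summable (\<lambda>n. b (Suc n) * z ^ Suc n)"
    by (rule summable_comparison_test'[OF sums_summable[OF sums_mult[OF g]] term_le])
  then show s0: "summable (\<lambda>n. b n * z ^ n)" by (subst (asm) summable_Suc_iff)
  have e1: "(\<Sum>n. b n * z ^ n) = (\<Sum>n. b (Suc n) * z ^ Suc n)"
    using suminf_split_head[OF s0] b by simp
  have "norm (\<Sum>n. b (Suc n) * z ^ Suc n) \<le> 2 * norm z * (1 / (1 - K * norm z))"
    by (rule norm_sums_le[OF summable_sums[OF s1] sums_mult[OF g] term_le])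
  also have "\<dots> \<le> 2 * norm z * 2" by (intro mult_left_mono g2) auto
  finally show "norm (\<Sum>n. b n * z ^ n) \<le> 4 * norm z" using e1 by simp
  have s2: "summable (\<lambda>n. b (Suc (Suc n)) * z ^ Suc (Suc n))"
    using s1 by (subst (asm) summable_Suc_iff[symmetric])
  have e2: "(\<Sum>n. b n * z ^ n) - z = (\<Sum>n. b (Suc (Suc n)) * z ^ Suc (Suc n))"
    using suminf_split_head[OF s1] b e1 by simp
  have "norm (\<Sum>n. b (Suc (Suc n)) * z ^ Suc (Suc n)) \<le> 2 * K * norm (z\<^sup>2) * (1 / (1 - K * norm z))"
  proof (rule norm_sums_le[OF summable_sums[OF s2] sums_mult[OF g]])
    show "norm (b (Suc (Suc n)) * z ^ Suc (Suc n)) \<le> 2 * K * norm (z\<^sup>2) * (K * norm z) ^ n" for n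
      using term_le[of "Suc n"] by (simp add: norm_power power2_eq_square norm_mult mult_ac)
  qed
  also have "\<dots> \<le> 2 * K * norm (z\<^sup>2) * 2" using K by (intro mult_left_mono g2) auto
  finally show "norm ((\<Sum>n. b n * z ^ n) - z) \<le> 4 * K * norm (z\<^sup>2)" using e2 by simp
qed

lemma norm_rot [simp]: "norm (rot \<alpha> z) = norm z"
  by (simp add: rot_def norm_mult norm_exp_eq_Re)

text \<open>The rotation preserves the disk and \<open>\<phi>\<close> maps it into the domain of
  \<open>g\<close>, so both sides are holomorphic on the whole disk; their difference has zero
  expansion at 0 and vanishes by the identity theorem.\<close>

lemma conjugacy_of_formal_conjugacy:
  assumes hol: "g holomorphic_on ball 0 1" "\<phi> holomorphic_on ball 0 \<delta>" "\<delta> > 0"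
    and sub: "\<phi> ` ball 0 \<delta> \<subseteq> ball 0 1"
    and ex: "g has_fps_expansion F" "\<phi> has_fps_expansion P" "P $ 0 = 0"
    and conj: "F oo P = P oo (fps_const (exp (2 * of_real pi * \<i> * of_real \<alpha>)) * fps_X)"
    and z: "z \<in> ball 0 \<delta>"
  shows "\<phi> (rot \<alpha> z) = g (\<phi> z)"
proof -
  define \<mu> where "\<mu> = exp (2 * of_real pi * \<i> * complex_of_real \<alpha>)"
  have r: "rot \<alpha> = (\<lambda>z. \<mu> * z)" by (simp add: rot_def \<mu>_def fun_eq_iff)
  have "(\<lambda>z. (g \<circ> \<phi>) z - (\<phi> \<circ> (\<lambda>z. \<mu> * z)) z) has_fps_expansion (F oo P) - (P oo (fps_const \<mu> * fps_X))"
    by (intro fps_expansion_intros has_fps_expansion_compose ex) auto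
  then have 0: "(\<lambda>z. (g \<circ> \<phi>) z - (\<phi> \<circ> rot \<alpha>) z) has_fps_expansion 0"
    using conj by (simp add: \<mu>_def r)
  have "rot \<alpha> holomorphic_on ball 0 \<delta>" unfolding r by (intro holomorphic_intros)
  then have "(\<phi> \<circ> rot \<alpha>) holomorphic_on ball 0 \<delta>"
    by (rule holomorphic_on_compose_gen[OF _ hol(2)]) auto
  moreover have "(g \<circ> \<phi>) holomorphic_on ball 0 \<delta>"
    by (rule holomorphic_on_compose_gen[OF hol(2,1) sub])
  ultimately have "(\<lambda>z. (g \<circ> \<phi>) z - (\<phi> \<circ> rot \<alpha>) z) holomorphic_on ball 0 \<delta>"
    by (intro holomorphic_intros)
  from has_fps_expansion_0_analytic_continuation[OF 0 this _ _ _ z] hol(3)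
  show ?thesis by simp
qed

theorem proposition34:
  fixes I :: "real set" and f :: "real \<Rightarrow> complex \<Rightarrow> complex"
  assumes "open I"
    and "real_complex_analytic_on f (I \<times> ball 0 1)"
    and "\<And>\<alpha>. \<alpha> \<in> I \<Longrightarrow> f \<alpha> holomorphic_on ball 0 1"
    and "\<And>\<alpha>. \<alpha> \<in> I \<Longrightarrow> f \<alpha> 0 = 0"
    and "\<And>\<alpha>. \<alpha> \<in> I \<Longrightarrow> deriv (f \<alpha>) 0 = exp (2 * of_real pi * \<i> * of_real \<alpha>)"
  shows "degenerate f I \<longleftrightarrow>
    (\<exists>(J :: real set) (\<delta> :: real) (\<phi> :: real \<Rightarrow> complex \<Rightarrow> complex).
       open J \<and> is_interval J \<and> J \<noteq> {} \<and> J \<subseteq> I \<and> \<delta> > 0 \<and>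
       real_complex_analytic_on \<phi> (J \<times> ball 0 \<delta>) \<and>
       (\<forall>\<alpha> \<in> J.
          (\<lambda>z. \<phi> \<alpha> z - z) \<in> O[nhds 0](\<lambda>z. z ^ 2) \<and>
          \<phi> \<alpha> ` ball 0 \<delta> \<subseteq> ball 0 1 \<and>
          (\<forall>z \<in> ball 0 \<delta>. \<phi> \<alpha> (rot \<alpha> z) = f \<alpha> (\<phi> \<alpha> z))))"
proof
  assume "degenerate f I"
  then obtain x where x: "x \<in> I" "x \<notin> closure {\<alpha> \<in> I. \<not> linearizable (f \<alpha>) \<alpha>}"
    unfolding degenerate_def by blast
  have "open (I - closure {\<alpha> \<in> I. \<not> linearizable (f \<alpha>) \<alpha>})"
    using assms(1) by (intro open_Diff) auto
  then obtain e where e: "e > 0" "ball x e \<subseteq> I - closure {\<alpha> \<in> I. \<not> linearizable (f \<alpha>) \<alpha>}"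
    using x openE by blast
  then have eI: "ball x e \<subseteq> I" by blast
  have lin: "linearizable (f \<alpha>) \<alpha>" if "\<alpha> \<in> ball x e" for \<alpha>
    using e(2) closure_subset[of "{\<alpha> \<in> I. \<not> linearizable (f \<alpha>) \<alpha>}"] that by blast
  obtain b :: "nat \<Rightarrow> complex \<Rightarrow> complex" and F \<rho> K where \<rho>: "0 < \<rho>" "\<rho> \<le> e" and K: "K > 0"
    and hol: "\<And>n. b n holomorphic_on ball (of_real x) \<rho>"
    and b: "\<And>\<xi>. b 0 \<xi> = 0" "\<And>\<xi>. b 1 \<xi> = 1"
      "\<And>n \<xi>. \<xi> \<in> ball (of_real x) \<rho> \<Longrightarrow> norm (b (Suc n) \<xi>) \<le> 2 * K ^ n"
    and F: "\<And>\<alpha>. \<alpha> \<in> ball x \<rho> \<Longrightarrow> f \<alpha> has_fps_expansion F \<alpha>"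
      "\<And>\<alpha>. \<alpha> \<in> ball x \<rho> \<Longrightarrow> F \<alpha> oo Abs_fps (\<lambda>n. b n (of_real \<alpha>)) =
        Abs_fps (\<lambda>n. b n (of_real \<alpha>)) oo (fps_const (exp (2 * of_real pi * \<i> * of_real \<alpha>)) * fps_X)"
    by (rule local_analytic_linearization[OF assms(2,4,5) e(1) eI lin])
      (assumption, assumption, assumption, rule that)
  define \<phi> where "\<phi> = (\<lambda>\<alpha> z. \<Sum>n. b n (complex_of_real \<alpha>) * z ^ n)"
  \<comment> \<open>The first term is the range of the series bounds; the second, with
    \<open>norm (\<phi> \<alpha> z) \<le> 4 * norm z\<close>, keeps the image inside the unit
    disk.\<close>
  define \<delta> where "\<delta> = min (1 / (2 * K)) (1 / 8)"
  have \<delta>: "\<delta> > 0" "\<delta> \<le> 1 / (2 * K)" "\<delta> \<le> 1 / 8" using K by (auto simp: \<delta>_def)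
  \<comment> \<open>Shifting the index in \<open>2 * K ^ n\<close> costs the factor
    \<open>1 / K\<close>; degree 0 is covered because \<open>b 0\<close> vanishes.\<close>
  have "norm (b n \<xi>) \<le> 2 / K * K ^ n" if "\<xi> \<in> ball (of_real x) \<rho>" for n \<xi>
    using b(1) b(3)[OF that] K by (cases n) auto
  then have an: "real_complex_analytic_on \<phi> (ball x \<rho> \<times> ball 0 (1 / K))"
    unfolding \<phi>_def by (rule real_complex_analytic_on_power_series[OF hol _ K])
  have "1 / (2 * K) < 1 / K" using K by (simp add: field_simps)
  then have "\<delta> < 1 / K" using \<delta>(2) by linarith
  then have "ball 0 \<delta> \<subseteq> ball (0::complex) (1 / K)" by auto
  then have an\<delta>: "real_complex_analytic_on \<phi> (ball x \<rho> \<times> ball 0 \<delta>)"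
    using an unfolding real_complex_analytic_on_def by blast
  have "(\<lambda>z. \<phi> \<alpha> z - z) \<in> O[nhds 0](\<lambda>z. z ^ 2) \<and> \<phi> \<alpha> ` ball 0 \<delta> \<subseteq> ball 0 1 \<and>
      (\<forall>z \<in> ball 0 \<delta>. \<phi> \<alpha> (rot \<alpha> z) = f \<alpha> (\<phi> \<alpha> z))" if \<alpha>: "\<alpha> \<in> ball x \<rho>" for \<alpha>
  proof -
    have "of_real \<alpha> \<in> ball (complex_of_real x) \<rho>" using \<alpha> by (simp add: dist_of_real)
    note bounds = normalized_power_series_bounds[of "\<lambda>n. b n (of_real \<alpha>)" K, OF b(1,2) b(3)[OF this] K]
    have z\<delta>: "norm z < 1 / (2 * K)" if "z \<in> ball 0 \<delta>" for z :: complex using that \<delta> by simp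
    have near: "\<forall>\<^sub>F z::complex in nhds 0. z \<in> ball 0 \<delta>"
      using \<delta>(1) by (intro eventually_nhds_in_open) auto
    then have "\<forall>\<^sub>F z in nhds 0. norm (\<phi> \<alpha> z - z) \<le> 4 * K * norm (z ^ 2)"
      by (rule eventually_mono) (use bounds(3) z\<delta> in \<open>auto simp: \<phi>_def\<close>)
    then have bigo: "(\<lambda>z. \<phi> \<alpha> z - z) \<in> O[nhds 0](\<lambda>z. z ^ 2)" by (rule bigoI)
    have sub: "\<phi> \<alpha> ` ball 0 \<delta> \<subseteq> ball 0 1"
    proof (rule image_subsetI)
      fix z :: complex assume z: "z \<in> ball 0 \<delta>"
      then have "norm (\<phi> \<alpha> z) \<le> 4 * norm z" unfolding \<phi>_def using bounds(2) z\<delta> by blast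
      then show "\<phi> \<alpha> z \<in> ball 0 1" using z \<delta> by simp
    qed
    have hol\<phi>: "\<phi> \<alpha> holomorphic_on ball 0 \<delta>"
      by (rule real_complex_analytic_on_imp_holomorphic[OF an\<delta>]) (use \<alpha> in auto)
    have "\<forall>\<^sub>F z in nhds 0. (\<lambda>n. Abs_fps (\<lambda>n. b n (of_real \<alpha>)) $ n * z ^ n) sums \<phi> \<alpha> z"
      using near
      by (rule eventually_mono) (use bounds(1) z\<delta> in \<open>auto simp: \<phi>_def intro!: summable_sums\<close>)
    then have "\<phi> \<alpha> has_fps_expansion Abs_fps (\<lambda>n. b n (of_real \<alpha>))"
      by (rule has_fps_expansionI)
    moreover have "\<alpha> \<in> I" using \<alpha> \<rho>(2) eI by auto
    ultimately have "\<phi> \<alpha> (rot \<alpha> z) = f \<alpha> (\<phi> \<alpha> z)" if "z \<in> ball 0 \<delta>" for z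
      using conjugacy_of_formal_conjugacy[OF assms(3) hol\<phi> \<delta>(1) sub F(1)[OF \<alpha>] _ _ F(2)[OF \<alpha>] that] b(1)
      by auto
    then show ?thesis using bigo sub by blast
  qed
  then show "\<exists>J \<delta> \<phi>. open J \<and> is_interval J \<and> J \<noteq> {} \<and> J \<subseteq> I \<and> \<delta> > 0 \<and>
       real_complex_analytic_on \<phi> (J \<times> ball 0 \<delta>) \<and>
       (\<forall>\<alpha> \<in> J.
          (\<lambda>z. \<phi> \<alpha> z - z) \<in> O[nhds 0](\<lambda>z. z ^ 2) \<and>
          \<phi> \<alpha> ` ball 0 \<delta> \<subseteq> ball 0 1 \<and>
          (\<forall>z \<in> ball 0 \<delta>. \<phi> \<alpha> (rot \<alpha> z) = f \<alpha> (\<phi> \<alpha> z)))"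
    using an\<delta> \<delta>(1) \<rho> eI
    by (intro exI[of _ "ball x \<rho>"] exI[of _ \<delta>] exI[of _ \<phi>]) (auto simp: is_interval_ball_real)
next
  assume "\<exists>(J :: real set) (\<delta> :: real) (\<phi> :: real \<Rightarrow> complex \<Rightarrow> complex).
       open J \<and> is_interval J \<and> J \<noteq> {} \<and> J \<subseteq> I \<and> \<delta> > 0 \<and>
       real_complex_analytic_on \<phi> (J \<times> ball 0 \<delta>) \<and>
       (\<forall>\<alpha> \<in> J.
          (\<lambda>z. \<phi> \<alpha> z - z) \<in> O[nhds 0](\<lambda>z. z ^ 2) \<and>
          \<phi> \<alpha> ` ball 0 \<delta> \<subseteq> ball 0 1 \<and>
          (\<forall>z \<in> ball 0 \<delta>. \<phi> \<alpha> (rot \<alpha> z) = f \<alpha> (\<phi> \<alpha> z)))"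
  then obtain J \<delta> \<phi> where J: "open J" "J \<noteq> {}" "J \<subseteq> I" and \<delta>: "\<delta> > 0"
    and an: "real_complex_analytic_on \<phi> (J \<times> ball 0 \<delta>)"
    and *: "\<forall>\<alpha> \<in> J. (\<lambda>z. \<phi> \<alpha> z - z) \<in> O[nhds 0](\<lambda>z. z ^ 2) \<and>
          \<phi> \<alpha> ` ball 0 \<delta> \<subseteq> ball 0 1 \<and>
          (\<forall>z \<in> ball 0 \<delta>. \<phi> \<alpha> (rot \<alpha> z) = f \<alpha> (\<phi> \<alpha> z))"
    by (elim exE conjE) (rule that)
  have \<phi>: "(\<lambda>z. \<phi> \<alpha> z - z) \<in> O[nhds 0](\<lambda>z. z ^ 2)"
    "z \<in> ball 0 \<delta> \<Longrightarrow> \<phi> \<alpha> (rot \<alpha> z) = f \<alpha> (\<phi> \<alpha> z)" if "\<alpha> \<in> J" for \<alpha> z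
    using bspec[OF * that] by blast+
  have lin: "linearizable (f \<alpha>) \<alpha>" if \<alpha>: "\<alpha> \<in> J" for \<alpha>
  proof (rule linearizableI)
    show "\<phi> \<alpha> holomorphic_on ball 0 \<delta>"
      by (rule real_complex_analytic_on_imp_holomorphic[OF an]) (use \<alpha> in auto)
    show "\<phi> \<alpha> 0 = 0" "deriv (\<phi> \<alpha>) 0 \<noteq> 0"
      using tangent_to_identity_of_bigo[OF \<phi>(1)[OF \<alpha>]] DERIV_imp_deriv by fastforce+
  qed (use \<delta> \<phi>(2)[OF \<alpha>] in auto)
  obtain x where x: "x \<in> J" using J by blast
  have "J \<inter> {\<alpha> \<in> I. \<not> linearizable (f \<alpha>) \<alpha>} = {}" using lin by blast
  then have "J \<inter> closure {\<alpha> \<in> I. \<not> linearizable (f \<alpha>) \<alpha>} = {}"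
    using open_Int_closure_eq_empty[OF J(1)] by blast
  then show "degenerate f I" unfolding degenerate_def using x J by blast
qed

end
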